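(* Let $n\ge 2$ be an integer, and let $\mathcal{A}$ be a unital $2$- and $(n-1)$-torsion free prime algebra over a commutative unital ring $\mathcal{R}$ with a nontrivial idempotent $e$; put $f=1-e$. Suppose that one of the following statements holds: (i-1) $e\mathcal{A}e=\mathcal{S}(e\mathcal{A}e)$ and $f\mathcal{A}f=\mathcal{S}(f\mathcal{A}f)$; (i-2) $e\mathcal{A}e=\mathcal{S}(e\mathcal{A}e)$ and $\mathcal{Z}(e\mathcal{A}e)=e\mathcal{Z}(\mathcal{A})e$; (i-3) $f\mathcal{A}f=\mathcal{S}(f\mathcal{A}f)$ and $\mathcal{Z}(f\mathcal{A}f)=f\mathcal{Z}(\mathcal{A})f$; (i-4) $\mathcal{Z}(e\mathcal{A}e)=e\mathcal{Z}(\mathcal{A})e$ and $\mathcal{Z}(f\mathcal{A}f)=f\mathcal{Z}(\mathcal{A})f$; and that one of the following statements also holds: (ii-1) $e\mathcal{A}e$ or $f\mathcal{A}f$ is noncommutative; (ii-2) $e\mathcal{A}e$ or $f\mathcal{A}f$ has no nonzero central ideal; (ii-3) $\mathcal{Z}(\mathcal{A})=\{a+b : a\in e\mathcal{Z}(\mathcal{A})e,\ b\in f\mathcal{Z}(\mathcal{A})f,\ am_0=m_0b\}$ for some $m_0\in e\mathcal{A}f$; (ii-4) $\mathcal{Z}(\mathcal{A})=\{a+b : a\in e\mathcal{Z}(\mathcal{A})e,\ b\in f\mathcal{Z}(\mathcal{A})f,\ t_0a=bt_0\}$ for some $t_0\in f\mathcal{A}e$; (ii-5) $e\mathcal{A}f\cdot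 f\mathcal{A}e=f\mathcal{A}e\cdot e\mathcal{A}f=\{0\}$. Then every Lie $n$-derivation on $\mathcal{A}$ is standard.
   Context: Linear means $\mathcal{R}$-linear; $\mathcal{Z}(\cdot)$ denotes the centre. $\mathcal{A}$ is prime if $a\mathcal{A}b=\{0\}$ implies $a=0$ or $b=0$. Nontrivial idempotent: $e^2=e$, $e\ne 0,1$. For a positive integer $k$, $\mathcal{A}$ is $k$-torsion free if $kx=0$ implies $x=0$ for each $x\in\mathcal{A}$. $[x,y]=xy-yx$. For an algebra $\mathcal{B}$, $\mathcal{S}(\mathcal{B})$ is the subalgebra of $\mathcal{B}$ generated by all idempotents and all commutators of $\mathcal{B}$; a central ideal of $\mathcal{B}$ is an ideal contained in $\mathcal{Z}(\mathcal{B})$. $e\mathcal{A}e$ and $f\mathcal{A}f$ are regarded as unital algebras with units $e$ and $f$. Define $p_1(x_1)=x_1$ and $p_n(x_1,\dots,x_n)=[p_{n-1}(x_1,\dots,x_{n-1}),x_n]$ for $n\ge2$; for $n\ge 2$, $p_n(x_1,\dots,x_n)$ is called an $(n-1)$-th commutator. A linear map $\varphi:\mathcal{A}\to\mathcal{A}$ is a Lie $n$-derivation if $\varphi(p_n(x_1,\dots,x_n))=\sum_{i=1}^n p_n(x_1,\dots,x_{i-1},\varphi(x_i),x_{i+1},\dots,x_n)$ for all $x_1,\dots,x_n\in\mathcal{A}$. A Lie $n$-derivation is standard if it equals $h+\tau$ with $h$ a derivation on $\mathcal{A}$ (linear, $h(xy)=h(x)y+xh(y)$) and $\tau$ a linear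 mapping from $\mathcal{A}$ into $\mathcal{Z}(\mathcal{A})$ vanishing on all $(n-1)$-th commutators of $\mathcal{A}$. *)

theory Defs
  imports Complex_Main
begin

(* The classes comm_ring_1 and ring_1 require 0 \<noteq> 1. This excludes only a zero algebra or zero
   base ring, and a prime algebra with a nontrivial idempotent has neither. *)
locale assoc_algebra = module scale
  for scale :: "'r::comm_ring_1 \<Rightarrow> 'a::ring_1 \<Rightarrow> 'a" (infixr "*s" 75) +
  assumes scale_mult_left: "(r *s x) * y = r *s (x * y)"
    and scale_mult_right: "x * (r *s y) = r *s (x * y)"

definition torsion_free :: "nat \<Rightarrow> 'a::ring_1 itself \<Rightarrow> bool" where
  "torsion_free k _ \<longleftrightarrow> (\<forall>x::'a. of_nat k * x = 0 \<longrightarrow> x = 0)"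

definition prime_algebra :: "'a::ring_1 itself \<Rightarrow> bool" where
  "prime_algebra _ \<longleftrightarrow>
     (\<forall>a b::'a. {a * x * b | x. x \<in> UNIV} = {0} \<longrightarrow> a = 0 \<or> b = 0)"

definition nontrivial_idempotent :: "'a::ring_1 \<Rightarrow> bool" where
  "nontrivial_idempotent e \<longleftrightarrow> e * e = e \<and> e \<noteq> 0 \<and> e \<noteq> 1"

definition commutator :: "'a::ring_1 \<Rightarrow> 'a \<Rightarrow> 'a" where
  "commutator x y = x * y - y * x"

(* Algebras such as eAe are represented by their underlying subset B of the ambient ring. *)

definition centre :: "'a::ring_1 set \<Rightarrow> 'a set" where
  "centre B = {z \<in> B. \<forall>b\<in>B. z * b = b * z}"

definition noncommutative :: "'a::ring_1 set \<Rightarrow> bool" where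
  "noncommutative B \<longleftrightarrow> (\<exists>x\<in>B. \<exists>y\<in>B. x * y \<noteq> y * x)"

definition sandwich :: "'a::ring_1 \<Rightarrow> 'a set \<Rightarrow> 'a \<Rightarrow> 'a set" where
  "sandwich e X f = {e * x * f | x. x \<in> X}"

definition subalgebra :: "('r::comm_ring_1 \<Rightarrow> 'a::ring_1 \<Rightarrow> 'a) \<Rightarrow> 'a set \<Rightarrow> 'a set \<Rightarrow> bool" where
  "subalgebra scale B T \<longleftrightarrow>
     T \<subseteq> B \<and> module.subspace scale T \<and> (\<forall>x\<in>T. \<forall>y\<in>T. x * y \<in> T)"

(* The unit of B is an idempotent of B, so it need not be added to the generators. *)
definition idem_comm_subalgebra :: "('r::comm_ring_1 \<Rightarrow> 'a::ring_1 \<Rightarrow> 'a) \<Rightarrow> 'a set \<Rightarrow> 'a set" where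
  "idem_comm_subalgebra scale B =
     subalgebra scale B hull
       ({u \<in> B. u * u = u} \<union> {commutator x y | x y. x \<in> B \<and> y \<in> B})"

definition central_ideal :: "('r::comm_ring_1 \<Rightarrow> 'a::ring_1 \<Rightarrow> 'a) \<Rightarrow> 'a set \<Rightarrow> 'a set \<Rightarrow> bool" where
  "central_ideal scale B I \<longleftrightarrow>
     I \<subseteq> B \<and> module.subspace scale I \<and> (\<forall>b\<in>B. \<forall>x\<in>I. b * x \<in> I \<and> x * b \<in> I) \<and>
     I \<subseteq> centre B"

definition no_nonzero_central_ideal ::
    "('r::comm_ring_1 \<Rightarrow> 'a::ring_1 \<Rightarrow> 'a) \<Rightarrow> 'a set \<Rightarrow> bool" where
  "no_nonzero_central_ideal scale B \<longleftrightarrow> (\<forall>I. central_ideal scale B I \<longrightarrow> I = {0})"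

(* iter_comm n x is p_n(x 1, ..., x n); only the values of x on {1..n} matter, and the value
   at n = 0 is a dummy. *)
fun iter_comm :: "nat \<Rightarrow> (nat \<Rightarrow> 'a::ring_1) \<Rightarrow> 'a" where
  "iter_comm 0 x = 0"
| "iter_comm (Suc 0) x = x 1"
| "iter_comm (Suc (Suc n)) x = commutator (iter_comm (Suc n) x) (x (Suc (Suc n)))"

definition lie_n_derivation ::
    "('r::comm_ring_1 \<Rightarrow> 'a::ring_1 \<Rightarrow> 'a) \<Rightarrow> nat \<Rightarrow> ('a \<Rightarrow> 'a) \<Rightarrow> bool" where
  "lie_n_derivation scale n \<phi> \<longleftrightarrow>
     module_hom scale scale \<phi> \<and>
     (\<forall>x. \<phi> (iter_comm n x) = (\<Sum>i=1..n. iter_comm n (x(i := \<phi> (x i)))))"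

definition derivation :: "('r::comm_ring_1 \<Rightarrow> 'a::ring_1 \<Rightarrow> 'a) \<Rightarrow> ('a \<Rightarrow> 'a) \<Rightarrow> bool" where
  "derivation scale h \<longleftrightarrow>
     module_hom scale scale h \<and> (\<forall>x y. h (x * y) = h x * y + x * h y)"

definition standard_lie_n_derivation ::
    "('r::comm_ring_1 \<Rightarrow> 'a::ring_1 \<Rightarrow> 'a) \<Rightarrow> nat \<Rightarrow> ('a \<Rightarrow> 'a) \<Rightarrow> bool" where
  "standard_lie_n_derivation scale n \<phi> \<longleftrightarrow>
     lie_n_derivation scale n \<phi> \<and>
     (\<exists>h \<tau>. derivation scale h \<and> module_hom scale scale \<tau> \<and> range \<tau> \<subseteq> centre UNIV \<and>
       (\<forall>x. \<tau> (iter_comm n x) = 0) \<and> (\<forall>a. \<phi> a = h a + \<tau> a))"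

end

theory Submission
  imports Defs
begin

text \<open>
  Write \<open>A\<close> for the algebra, \<open>A = eAe + eAf + fAe + fAf\<close>, with typical elements \<open>a\<close>, \<open>m\<close>, \<open>t\<close>, \<open>b\<close>
  of the four corners.  Primeness makes \<open>eAf\<close> faithful on both sides.  It follows that
  \<open>\<alpha> \<in> eAe\<close> and \<open>\<beta> \<in> fAf\<close> with \<open>\<alpha> m = m \<beta>\<close> for all \<open>m\<close> have a central sum
  (\<open>centre_criterion\<close>).  Nearly every central element below is produced in this way.

  An inner derivation makes \<open>\<phi> e\<close> diagonal, and \<open>(n - 1)\<close>-torsion freeness then makes it
  central (\<open>idempotent_image_central\<close>); the same holds for \<open>\<phi> f\<close>.  Filling unused slots of the
  defining identity with \<open>e\<close> now lets \<open>\<phi>\<close> be treated as a Lie derivation, or a Lie triple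
  derivation, up to the operator \<open>[\<cdot>, e]\<close>, which acts by signs on the corners.  Hence \<open>\<phi>\<close>
  preserves \<open>eAf\<close> and \<open>fAe\<close>, and it preserves their diagonal complement.  The step that takes
  work is to exclude a component \<open>eAf \<rightarrow> fAe\<close> when \<open>n\<close> is odd (\<open>\<phi>_ef_fe_component_odd\<close>).

  What prevents \<open>\<phi>\<close> from preserving \<open>eAe\<close> is the component \<open>f \<phi>(a) f\<close>, which lies in the
  centre of \<open>fAf\<close>.  Comparing \<open>\<phi> ((a a') m)\<close> with \<open>\<phi> (a (a' m))\<close> shows that the \<open>a\<close> for which it
  extends to a central element of \<open>A\<close> form a subalgebra of \<open>eAe\<close> that contains all
  idempotents and commutators.  So it always extends if \<open>eAe\<close> is generated by these, and
  also if every central element of \<open>fAf\<close> extends (\<open>ff_part_extends\<close>).  The situation for \<open>fAf\<close> is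
  symmetric.  These extensions form a linear map \<open>\<tau>\<close> into the centre, and \<open>h = \<phi> - \<tau>\<close>
  preserves all corners.

  The Leibniz rule for \<open>h\<close> is immediate on a diagonal and an off-diagonal corner, and on
  a pair of elements of one diagonal corner it follows by faithfulness.  For \<open>m t\<close> and \<open>t m\<close>
  it can fail at first only by \<open>e z\<close> and \<open>- f z\<close> with \<open>z\<close> central.  Computing \<open>h (m t m)\<close> in two
  ways gives \<open>2 z m = 0\<close>, and since \<open>A\<close> is prime and 2-torsion free, \<open>z = 0\<close> or \<open>m = 0\<close>
  (\<open>ef_fe\<close>).
\<close>

section \<open>Iterated commutators\<close>

lemma centre_UNIV_iff: "z \<in> centre UNIV \<longleftrightarrow> (\<forall>x. z * x = x * z)"
  by (simp add: centre_def)

lemma centre_0: "0 \<in> centre UNIV"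
  by (simp add: centre_UNIV_iff)

lemma centre_add: "y \<in> centre UNIV \<Longrightarrow> z \<in> centre UNIV \<Longrightarrow> y + z \<in> centre UNIV"
  by (simp add: centre_UNIV_iff algebra_simps)

lemma centre_diff: "y \<in> centre UNIV \<Longrightarrow> z \<in> centre UNIV \<Longrightarrow> y - z \<in> centre UNIV"
  by (simp add: centre_UNIV_iff algebra_simps)

lemma iter_comm_Suc: "n \<ge> 1 \<Longrightarrow> iter_comm (Suc n) x = commutator (iter_comm n x) (x (Suc n))"
  by (cases n) auto

lemma iter_comm_cong: "(\<And>i. 1 \<le> i \<Longrightarrow> i \<le> n \<Longrightarrow> x i = y i) \<Longrightarrow> iter_comm n x = iter_comm n y"
proof (induction n)
  case (Suc n)
  then show ?case by (cases n) auto
qed simp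

lemma iter_comm_update_diff:
  assumes "1 \<le> i" "i \<le> n"
  shows "iter_comm n (x(i := u - v)) = iter_comm n (x(i := u)) - iter_comm n (x(i := v))"
  using assms
proof (induction n)
  case (Suc n)
  show ?case
  proof (cases "n = 0")
    case True
    then show ?thesis using Suc.prems by (auto simp: le_Suc_eq)
  next
    case n: False
    show ?thesis
    proof (cases "i = Suc n")
      case True
      have "iter_comm n (x(i := w)) = iter_comm n x" for w
        by (rule iter_comm_cong) (use True in auto)
      then show ?thesis using n True
        by (simp add: iter_comm_Suc commutator_def algebra_simps del: fun_upd_apply)
          (simp add: algebra_simps)
    next
      case False
      then show ?thesis using Suc.prems n
        by (simp add: iter_comm_Suc commutator_def Suc.IH left_diff_distrib right_diff_distrib
            fun_upd_other del: fun_upd_apply)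
    qed
  qed
qed simp

lemma iter_comm_central_entry:
  assumes "c \<in> centre UNIV" "1 \<le> i" "i \<le> n" "2 \<le> n"
  shows "iter_comm n (x(i := c)) = 0"
  using assms(2-)
proof (induction n)
  case (Suc n)
  have c: "commutator u c = 0" "commutator c u = 0" for u
    using assms(1) by (simp_all add: centre_UNIV_iff commutator_def)
  consider "i = Suc n" | "i \<le> n" "n = 1" | "i \<le> n" "2 \<le> n"
    using Suc.prems by linarith
  then show ?case
  proof cases
    case 1
    then show ?thesis using Suc.prems by (simp add: iter_comm_Suc c)
  next
    case 2
    then have "i = 1" using Suc.prems by simp
    with 2 show ?thesis by (simp add: c)
  next
    case 3
    then show ?thesis using Suc by (simp add: iter_comm_Suc commutator_def)
  qed
qed simp

definition iter_ad :: "nat \<Rightarrow> 'a::ring_1 \<Rightarrow> 'a \<Rightarrow> 'a" where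
  "iter_ad k c u = ((\<lambda>v. commutator v c) ^^ k) u"

lemma iter_ad_0 [simp]: "iter_ad 0 c u = u"
  by (simp add: iter_ad_def)

lemma iter_ad_Suc: "iter_ad (Suc k) c u = commutator (iter_ad k c u) c"
  by (simp add: iter_ad_def)

lemma iter_ad_add: "iter_ad k c (u + v) = iter_ad k c u + iter_ad k c v"
  by (induction k) (simp_all add: iter_ad_Suc commutator_def algebra_simps)

lemma iter_comm_padded:
  assumes "1 \<le> j" "\<And>i. j < i \<Longrightarrow> x i = c"
  shows "iter_comm (j + k) x = iter_ad k c (iter_comm j x)"
proof (induction k)
  case (Suc k)
  then show ?case using assms by (simp add: iter_comm_Suc iter_ad_Suc)
qed simp

lemma leibniz_iter_comm:
  fixes d :: "'a::ring_1 \<Rightarrow> 'a"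
  assumes diff: "\<And>x y. d (x - y) = d x - d y"
    and leibniz: "\<And>x y. d (x * y) = d x * y + x * d y"
  shows "d (iter_comm n x) = (\<Sum>i=1..n. iter_comm n (x(i := d (x i))))"
proof (induction n)
  case 0
  have "d 0 = 0" using diff[of 0 0] by simp
  then show ?case by simp
next
  case (Suc n)
  show ?case
  proof (cases "n = 0")
    case False
    then have n: "n \<ge> 1" by simp
    have comm: "d (commutator u v) = commutator (d u) v + commutator u (d v)" for u v
      by (simp add: commutator_def diff leibniz algebra_simps)
    have sum_comm: "commutator (sum g I) v = (\<Sum>i\<in>I. commutator (g i) v)"
      for g :: "nat \<Rightarrow> 'a" and I v
      by (simp add: commutator_def sum_distrib_left sum_distrib_right sum_subtractf)
    have last: "iter_comm n (x(Suc n := w)) = iter_comm n x" for w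
      by (rule iter_comm_cong) auto
    have "d (iter_comm (Suc n) x)
        = (\<Sum>i=1..n. commutator (iter_comm n (x(i := d (x i)))) (x (Suc n)))
          + commutator (iter_comm n x) (d (x (Suc n)))"
      using n by (simp add: iter_comm_Suc comm Suc.IH sum_comm del: fun_upd_apply)
    also have "\<dots> = (\<Sum>i=1..Suc n. iter_comm (Suc n) (x(i := d (x i))))"
    proof -
      have "(\<Sum>i=1..n. iter_comm (Suc n) (x(i := d (x i))))
          = (\<Sum>i=1..n. commutator (iter_comm n (x(i := d (x i)))) (x (Suc n)))"
        using n by (intro sum.cong) (auto simp: iter_comm_Suc fun_upd_other simp del: fun_upd_apply)
      moreover have "iter_comm (Suc n) (x(Suc n := d (x (Suc n))))
          = commutator (iter_comm n x) (d (x (Suc n)))"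
        using n by (simp add: iter_comm_Suc last fun_upd_same del: fun_upd_apply)
      ultimately show ?thesis by (simp del: fun_upd_apply)
    qed
    finally show ?thesis .
  qed simp
qed

lemma (in assoc_algebra) derivation_is_lie_n_derivation:
  assumes "derivation scale d"
  shows "lie_n_derivation scale n d"
proof -
  interpret d: module_hom scale scale d using assms by (simp add: derivation_def)
  show ?thesis unfolding lie_n_derivation_def
    using assms leibniz_iter_comm[of d n] d.diff d.module_hom_axioms
    by (simp add: derivation_def)
qed

lemma (in assoc_algebra) lie_n_derivation_diff:
  assumes "lie_n_derivation scale n \<phi>" "lie_n_derivation scale n \<psi>"
  shows "lie_n_derivation scale n (\<lambda>x. \<phi> x - \<psi> x)"
proof -
  interpret p: module_pair scale scale by unfold_locales
  have "module_hom scale scale (\<lambda>x. \<phi> x - \<psi> x)"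
    using assms by (intro p.module_hom_sub) (simp_all add: lie_n_derivation_def)
  then show ?thesis using assms unfolding lie_n_derivation_def
    by (simp add: iter_comm_update_diff sum_subtractf)
qed

text \<open>The tail of the argument list can be filled up with a fixed element \<open>c\<close>.  When
  \<open>\<phi> c\<close> is central, differentiating a filled slot contributes nothing, so the first \<open>j\<close> slots
  behave as they do for a Lie \<open>j\<close>-derivation, up to the operator \<open>[\<cdot>, c]\<close> applied
  \<open>n - j\<close> times.\<close>

lemma lie_n_derivation_padded:
  assumes lie: "lie_n_derivation scale n \<phi>" and c: "\<phi> c \<in> centre UNIV"
    and n: "2 \<le> n" and j: "1 \<le> j" "j \<le> n"
  shows "\<phi> (iter_ad (n - j) c (iter_comm j x))
       = (\<Sum>i=1..j. iter_ad (n - j) c (iter_comm j (x(i := \<phi> (x i)))))"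
proof -
  define y where "y = (\<lambda>i. if i \<le> j then x i else c)"
  have pad: "iter_comm n z = iter_ad (n - j) c (iter_comm j z)" if "\<And>i. j < i \<Longrightarrow> z i = c" for z
    using iter_comm_padded[of j z c "n - j"] j that by simp
  have "\<phi> (iter_comm n y) = (\<Sum>i=1..n. iter_comm n (y(i := \<phi> (y i))))"
    using lie by (simp add: lie_n_derivation_def)
  also have "\<dots> = (\<Sum>i=1..j. iter_comm n (y(i := \<phi> (y i))))"
  proof (rule sum.mono_neutral_right)
    show "\<forall>i\<in>{1..n} - {1..j}. iter_comm n (y(i := \<phi> (y i))) = 0"
      using c n by (auto simp: y_def intro!: iter_comm_central_entry)
  qed (use j in auto)
  also have "\<dots> = (\<Sum>i=1..j. iter_ad (n - j) c (iter_comm j (x(i := \<phi> (x i)))))"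
  proof (rule sum.cong)
    fix i assume i: "i \<in> {1..j}"
    then have "iter_comm n (y(i := \<phi> (y i))) = iter_ad (n - j) c (iter_comm j (y(i := \<phi> (y i))))"
      by (intro pad) (auto simp: y_def)
    also have "iter_comm j (y(i := \<phi> (y i))) = iter_comm j (x(i := \<phi> (x i)))"
      by (rule iter_comm_cong) (use i in \<open>auto simp: y_def\<close>)
    finally show "iter_comm n (y(i := \<phi> (y i))) = iter_ad (n - j) c (iter_comm j (x(i := \<phi> (x i))))" .
  qed simp
  also have "iter_comm n y = iter_ad (n - j) c (iter_comm j x)"
    using pad[of y] iter_comm_cong[of j y x] by (simp add: y_def)
  finally show ?thesis .
qed

section \<open>Peirce corners of a prime algebra\<close>

text \<open>For orthogonal idempotents with sum 1, \<open>corner p q\<close> carves out the Peirce component \<open>pAq\<close>.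
  The fixed-point form makes membership a single equation.\<close>

definition corner :: "'a::ring_1 \<Rightarrow> 'a \<Rightarrow> 'a \<Rightarrow> bool" where
  "corner p q x \<longleftrightarrow> p * x * q = x"

lemma corner_0: "corner p q 0"
  by (simp add: corner_def)

lemma corner_add: "corner p q x \<Longrightarrow> corner p q y \<Longrightarrow> corner p q (x + y)"
  by (simp add: corner_def algebra_simps)

lemma corner_diff: "corner p q x \<Longrightarrow> corner p q y \<Longrightarrow> corner p q (x - y)"
  by (simp add: corner_def algebra_simps)

lemma corner_uminus: "corner p q x \<Longrightarrow> corner p q (- x)"
  by (simp add: corner_def)

locale peirce_prime = assoc_algebra scale
  for scale :: "'r::comm_ring_1 \<Rightarrow> 'a::ring_1 \<Rightarrow> 'a" +
  fixes e f :: 'a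
  assumes ee [simp]: "e * e = e" and ff [simp]: "f * f = f"
    and ef [simp]: "e * f = 0" and fe [simp]: "f * e = 0"
    and unit: "e + f = 1"
    and e_nonzero: "e \<noteq> 0" and f_nonzero: "f \<noteq> 0"
    and prime: "(\<And>x. a * x * b = 0) \<Longrightarrow> a = 0 \<or> b = (0::'a)"
    and two: "x + x = 0 \<Longrightarrow> x = (0::'a)"
begin

lemma swap: "peirce_prime scale f e"
  by unfold_locales (fact ff ee fe ef f_nonzero e_nonzero prime two | simp add: unit add.commute)+

lemma assoc_simps [simp]:
  "e * (e * x) = e * x" "f * (f * x) = f * x" "e * (f * x) = 0" "f * (e * x) = 0"
  by (simp_all flip: mult.assoc)

lemma corner_compress: "corner e e (e * x * e)" "corner e f (e * x * f)"
  "corner f e (f * x * e)" "corner f f (f * x * f)"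
  by (simp_all add: corner_def mult.assoc)

lemma corner_left: "corner e q x \<Longrightarrow> e * x = x" "corner e q x \<Longrightarrow> f * x = 0"
  "corner f q x \<Longrightarrow> f * x = x" "corner f q x \<Longrightarrow> e * x = 0"
  unfolding corner_def by (metis assoc_simps mult.assoc)+

lemma corner_right: "corner p e x \<Longrightarrow> x * e = x" "corner p e x \<Longrightarrow> x * f = 0"
  "corner p f x \<Longrightarrow> x * f = x" "corner p f x \<Longrightarrow> x * e = 0"
  unfolding corner_def by (metis ee ff ef fe mult.assoc mult_zero_right)+

lemmas corner_simps = corner_left corner_right

lemma corner_mult: "corner p e x \<Longrightarrow> corner e q y \<Longrightarrow> corner p q (x * y)"
  "corner p f x \<Longrightarrow> corner f q y \<Longrightarrow> corner p q (x * y)"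
  unfolding corner_def by (metis assoc_simps mult.assoc)+

lemma corner_orth: "corner p e x \<Longrightarrow> corner f q y \<Longrightarrow> x * y = 0"
  "corner p f x \<Longrightarrow> corner e q y \<Longrightarrow> x * y = 0"
  by (metis corner_left(3) corner_right(2) mult.assoc mult_zero_left)
    (metis corner_left(1) corner_right(4) mult.assoc mult_zero_left)

lemma peirce_decomposition: "x = e * x * e + e * x * f + f * x * e + f * x * f"
proof -
  have "x = (e + f) * x * (e + f)" by (simp add: unit)
  then show ?thesis by (simp add: algebra_simps)
qed

text \<open>In a prime algebra \<open>x A f = 0\<close> forces \<open>x = 0\<close>.  This and its mirror image turn identities
  tested against \<open>eAf\<close> into identities in the diagonal corners.\<close>

lemma corner_e_faithful:
  assumes "corner p e x" and "\<And>m. corner e f m \<Longrightarrow> x * m = 0"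
  shows "x = 0"
proof -
  have "x * y * f = 0" for y
    using assms(2)[OF corner_compress(2), of y] assms(1) by (simp add: corner_simps flip: mult.assoc)
  then show ?thesis using prime f_nonzero by blast
qed

lemma corner_f_faithful:
  assumes "corner f q x" and "\<And>m. corner e f m \<Longrightarrow> m * x = 0"
  shows "x = 0"
proof -
  have "e * y * x = 0" for y
    using assms(2)[OF corner_compress(2), of y] assms(1) by (simp add: corner_simps mult.assoc)
  then show ?thesis using prime e_nonzero by blast
qed

lemma centre_regular:
  fixes x z :: 'a
  assumes "z \<in> centre UNIV" "z * x = 0"
  shows "z = 0 \<or> x = 0"
proof (rule prime[of z x])
  fix y
  have "z * y * x = y * (z * x)"
    using assms(1) unfolding centre_UNIV_iff by (metis mult.assoc)
  then show "z * y * x = 0" using assms(2) by simp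
qed

text \<open>The relation \<open>\<alpha> m = m \<beta>\<close> on \<open>eAf\<close> already forces \<open>\<alpha> + \<beta>\<close> to commute with the
  diagonal corners, because \<open>eAf\<close> is a faithful bimodule; it then commutes with \<open>fAe\<close> too, since
  \<open>(t \<alpha> - \<beta> t) m = t m \<beta> - \<beta> t m = 0\<close>.\<close>

lemma centre_criterion:
  assumes a: "corner e e \<alpha>" and b: "corner f f \<beta>"
    and ab: "\<And>m. corner e f m \<Longrightarrow> \<alpha> * m = m * \<beta>"
  shows "\<alpha> + \<beta> \<in> centre UNIV"
proof -
  have 1: "\<alpha> * x = x * \<alpha>" if x: "corner e e x" for x
  proof -
    have "\<alpha> * x - x * \<alpha> = 0"
    proof (rule corner_e_faithful)
      fix m assume m: "corner e f m"
      have "\<alpha> * (x * m) = x * m * \<beta>" using ab[OF corner_mult(1)[OF x m]] .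
      also have "\<dots> = x * (\<alpha> * m)" using ab[OF m] by (simp add: mult.assoc)
      finally show "(\<alpha> * x - x * \<alpha>) * m = 0" by (simp add: algebra_simps)
    qed (use a x in \<open>auto intro: corner_diff corner_mult\<close>)
    then show ?thesis by simp
  qed
  have 2: "\<beta> * y = y * \<beta>" if y: "corner f f y" for y
  proof -
    have "\<beta> * y - y * \<beta> = 0"
    proof (rule corner_f_faithful)
      fix m assume m: "corner e f m"
      have "m * y * \<beta> = \<alpha> * (m * y)" using ab[OF corner_mult(2)[OF m y]] ..
      also have "\<dots> = m * \<beta> * y" using ab[OF m] by (simp flip: mult.assoc)
      finally show "m * (\<beta> * y - y * \<beta>) = 0" by (simp add: algebra_simps)
    qed (use b y in \<open>auto intro: corner_diff corner_mult\<close>)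
    then show ?thesis by simp
  qed
  have 3: "\<beta> * t = t * \<alpha>" if t: "corner f e t" for t
  proof -
    have "t * \<alpha> - \<beta> * t = 0"
    proof (rule corner_e_faithful)
      fix m assume m: "corner e f m"
      have "t * \<alpha> * m = t * m * \<beta>" using ab[OF m] by (simp add: mult.assoc)
      also have "\<dots> = \<beta> * (t * m)" using 2[OF corner_mult(1)[OF t m]] by simp
      finally show "(t * \<alpha> - \<beta> * t) * m = 0" by (simp add: algebra_simps)
    qed (use a b t in \<open>auto intro!: corner_diff intro: corner_mult\<close>)
    then show ?thesis by simp
  qed
  have "(\<alpha> + \<beta>) * x = x * (\<alpha> + \<beta>)" for x
  proof -
    define a' m t b' where d: "a' = e * x * e" "m = e * x * f" "t = f * x * e" "b' = f * x * f"
    have c: "corner e e a'" "corner e f m" "corner f e t" "corner f f b'"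
      unfolding d by (rule corner_compress)+
    have "(\<alpha> + \<beta>) * (a' + m + t + b') = (a' + m + t + b') * (\<alpha> + \<beta>)"
      using 1[OF c(1)] ab[OF c(2)] 3[OF c(3)] 2[OF c(4)] a b c
      by (simp add: distrib_left distrib_right corner_orth(1)[OF a c(3)] corner_orth(1)[OF a c(4)]
          corner_orth(2)[OF b c(1)] corner_orth(2)[OF b c(2)] corner_orth(1)[OF c(1) b]
          corner_orth(2)[OF c(2) a] corner_orth(1)[OF c(3) b] corner_orth(2)[OF c(4) a])
    then show ?thesis using peirce_decomposition[of x] by (simp add: d)
  qed
  then show ?thesis by (simp add: centre_UNIV_iff)
qed

text \<open>\<open>[\<cdot>, e]\<close> has eigenvalue \<open>-1\<close> on \<open>eAf\<close>, \<open>1\<close> on \<open>fAe\<close> and \<open>0\<close> on the diagonal corners.\<close>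

lemma iter_ad_compress:
  "e * iter_ad k e x * f = (-1) ^ k * (e * x * f)"
  "f * iter_ad k e x * e = f * x * e"
proof (induction k)
  case (Suc k)
  {
    case 1
    have "e * (u * e - e * u) * f = - (e * u * f)" for u
      by (simp add: algebra_simps)
    then show ?case using Suc(1) by (simp add: iter_ad_Suc commutator_def)
  next
    case 2
    have "f * (u * e - e * u) * e = f * u * e" for u
      by (simp add: algebra_simps)
    then show ?case using Suc(2) by (simp add: iter_ad_Suc commutator_def)
  }
qed simp_all

lemma iter_ad_pos_compress:
  assumes "k \<ge> 1"
  shows "e * iter_ad k e x * e = 0" "f * iter_ad k e x * f = 0"
  using assms by (cases k; simp add: iter_ad_Suc commutator_def algebra_simps)+

lemma iter_ad_ef: "corner e f m \<Longrightarrow> iter_ad k e m = (-1) ^ k * m"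
proof (induction k)
  case (Suc k)
  then show ?case
    by (cases "even k") (simp_all add: iter_ad_Suc commutator_def corner_simps)
qed simp

lemma iter_ad_fe: "corner f e t \<Longrightarrow> iter_ad k e t = t"
  by (induction k) (simp_all add: iter_ad_Suc commutator_def corner_simps)

lemma iter_ad_diag: "x * e = e * x \<Longrightarrow> k \<ge> 1 \<Longrightarrow> iter_ad k e x = 0"
proof (induction k)
  case (Suc k)
  then show ?case by (cases k) (simp_all add: iter_ad_Suc commutator_def)
qed simp

end

section \<open>Lie derivations that are central on the idempotents\<close>

context peirce_prime
begin

text \<open>In the expansion of \<open>\<phi> [m, e, \<dots>, e]\<close> for \<open>m \<in> eAf\<close>, the term \<open>[\<phi> m, e, \<dots>, e]\<close>
  has the same \<open>eAf\<close>-component as the left-hand side.  Each of the \<open>n - 1\<close> copies of \<open>e\<close>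
  contributes the same element \<open>\<plusminus>[m, \<phi> e]\<close> of \<open>eAf\<close>, so \<open>(n - 1)[m, \<phi> e] = 0\<close>.  Thus the
  diagonal element \<open>\<phi> e\<close> commutes with \<open>eAf\<close>.\<close>

lemma idempotent_image_central:
  assumes lie: "lie_n_derivation scale n \<phi>" and n: "2 \<le> n"
    and torsion: "\<And>x::'a. of_nat (n - 1) * x = 0 \<Longrightarrow> x = 0"
    and diag: "e * \<phi> e * f = 0" "f * \<phi> e * e = 0"
  shows "\<phi> e \<in> centre UNIV"
proof -
  define c where "c = \<phi> e"
  have c: "c = e * c * e + f * c * f"
    using peirce_decomposition[of c] diag by (simp add: c_def)
  have comm: "commutator m c = 0" if m: "corner e f m" for m
  proof -
    have mc: "corner e f (commutator m c)"
    proof -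
      have "commutator m c = m * (f * c * f) - (e * c * e) * m"
        using corner_orth(2)[OF m corner_compress(1)] corner_orth(2)[OF corner_compress(4) m]
        by (subst (1) c) (simp add: commutator_def distrib_left distrib_right)
      then show ?thesis using m by (simp add: corner_diff corner_mult corner_compress)
    qed
    define x where "x = (\<lambda>i::nat. if i = 1 then m else e)"
    have x: "iter_comm (Suc k) (x(1 := u)) = iter_ad k e u" for k u
      using iter_comm_padded[of 1 "x(1 := u)" e k] by (simp add: x_def)
    have x': "iter_comm (Suc k) x = iter_ad k e m" for k
      using iter_comm_padded[of 1 x e k] by (simp add: x_def)
    have x1: "x i = e" if "2 \<le> i" for i
      using that by (simp add: x_def)
    \<comment> \<open>With \<open>c\<close> in a single slot, each \<open>e\<close> before or after it only changes the sign.\<close>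
    have slot: "iter_comm (Suc (Suc k)) (x(i := c)) = (-1) ^ k * commutator m c"
      if "2 \<le> i" "i \<le> Suc (Suc k)" for i k
      using that
    proof (induction k)
      case 0
      then have "i = 2" by simp
      then show ?case by (simp add: x_def)
    next
      case (Suc k)
      show ?case
      proof (cases "i = Suc (Suc (Suc k))")
        case True
        then have "iter_comm (Suc (Suc k)) (x(i := c)) = iter_comm (Suc (Suc k)) x"
          by (intro iter_comm_cong) auto
        with True have "iter_comm (Suc (Suc (Suc k))) (x(i := c)) = commutator (iter_ad (Suc k) e m) c"
          by (simp only: iter_comm.simps x' fun_upd_same)
        also have "\<dots> = (-1) ^ Suc k * commutator m c"
          using iter_ad_ef[OF m, of "Suc k"] by (cases "even k") (simp_all add: commutator_def)
        finally show ?thesis .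
      next
        case False
        then have IH: "iter_comm (Suc (Suc k)) (x(i := c)) = (-1) ^ k * commutator m c"
          using Suc by (simp del: iter_comm.simps fun_upd_apply)
        have "iter_comm (Suc (Suc (Suc k))) (x(i := c))
            = commutator (iter_comm (Suc (Suc k)) (x(i := c))) e"
          using False x1[of "Suc (Suc (Suc k))"] by (simp add: fun_upd_other del: fun_upd_apply)
        also have "\<dots> = (-1) ^ Suc k * commutator m c"
          unfolding IH using mc
          by (cases "even k") (simp_all add: commutator_def[of _ e] corner_simps)
        finally show ?thesis .
      qed
    qed
    obtain k where k: "n = Suc (Suc k)" using n by (metis add_2_eq_Suc le_Suc_ex)
    have hom: "\<phi> (- y) = - \<phi> y" for y
      using lie unfolding lie_n_derivation_def by (blast intro: module_hom.neg)
    have hom': "\<phi> ((-1) ^ j * y) = (-1) ^ j * \<phi> y" for y j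
      by (cases "even j") (simp_all add: hom)
    have "\<phi> (iter_comm n x) = (\<Sum>i=1..n. iter_comm n (x(i := \<phi> (x i))))"
      using lie by (simp add: lie_n_derivation_def)
    also have "\<dots> = iter_comm n (x(1 := \<phi> m)) + (\<Sum>i=2..n. iter_comm n (x(i := \<phi> (x i))))"
      using n by (simp add: sum.atLeast_Suc_atMost numeral_2_eq_2 x_def)
    also have "(\<Sum>i=2..n. iter_comm n (x(i := \<phi> (x i)))) = (\<Sum>i=2..n. (-1) ^ k * commutator m c)"
      by (intro sum.cong) (use slot k in \<open>auto simp: x1 c_def simp del: iter_comm.simps fun_upd_apply\<close>)
    also have "\<dots> = of_nat (n - 1) * ((-1) ^ k * commutator m c)"
      by simp
    also have "iter_comm n (x(1 := \<phi> m)) = iter_ad (Suc k) e (\<phi> m)"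
      using x[of "Suc k" "\<phi> m"] by (simp add: k del: iter_comm.simps)
    also have "\<phi> (iter_comm n x) = (-1) ^ Suc k * \<phi> m"
      using x'[of "Suc k"] iter_ad_ef[OF m, of "Suc k"] hom'[of "Suc k" m] k by metis
    finally have eq: "(-1) ^ Suc k * \<phi> m
        = iter_ad (Suc k) e (\<phi> m) + of_nat (n - 1) * ((-1) ^ k * commutator m c)" .
    have "e * ((-1) ^ Suc k * \<phi> m) * f
        = e * iter_ad (Suc k) e (\<phi> m) * f + e * (of_nat (n - 1) * ((-1) ^ k * commutator m c)) * f"
      unfolding eq by (simp add: distrib_left distrib_right)
    moreover have "e * ((-1) ^ Suc k * \<phi> m) * f = (-1) ^ Suc k * (e * \<phi> m * f)"
      by (cases "even k") simp_all
    moreover have "e * (of_nat (n - 1) * ((-1) ^ k * commutator m c)) * f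
        = of_nat (n - 1) * ((-1) ^ k * commutator m c)"
    proof -
      have "corner e f ((-1) ^ k * commutator m c)"
        using mc by (cases "even k") (simp_all add: corner_uminus)
      moreover have "e * (of_nat j * y) * f = of_nat j * (e * y * f)" for j y
        by (simp add: mult.assoc[symmetric] mult_of_nat_commute[symmetric])
      ultimately show ?thesis by (simp only: corner_def)
    qed
    ultimately have "of_nat (n - 1) * ((-1) ^ k * commutator m c) = 0"
      using iter_ad_compress(1)[of "Suc k" "\<phi> m"] by simp
    then have "(-1) ^ k * commutator m c = 0" by (rule torsion)
    then show ?thesis by (cases "even k") simp_all
  qed
  have "e * c * e + f * c * f \<in> centre UNIV"
  proof (rule centre_criterion)
    fix m assume m: "corner e f m"
    have "m * c = c * m" using comm[OF m] by (simp add: commutator_def)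
    then have "m * (e * c * e + f * c * f) = (e * c * e + f * c * f) * m" using c by simp
    then show "e * c * e * m = m * (f * c * f)"
      using corner_orth(2)[OF m corner_compress(1)] corner_orth(2)[OF corner_compress(4) m]
      by (simp add: distrib_left distrib_right)
  qed (simp_all add: corner_compress)
  then show ?thesis using c c_def by simp
qed

end

locale normalised_lie_derivation = peirce_prime scale e f
  for scale :: "'r::comm_ring_1 \<Rightarrow> 'a::ring_1 \<Rightarrow> 'a" and e f :: 'a +
  fixes n :: nat and \<phi> :: "'a \<Rightarrow> 'a"
  assumes lie: "lie_n_derivation scale n \<phi>" and n_ge_2: "2 \<le> n"
    and \<phi>_e_central: "\<phi> e \<in> centre UNIV" and \<phi>_f_central: "\<phi> f \<in> centre UNIV"
begin

lemma swap_normalised: "normalised_lie_derivation scale f e n \<phi>"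
  by (intro normalised_lie_derivation.intro swap normalised_lie_derivation_axioms.intro
      lie n_ge_2 \<phi>_e_central \<phi>_f_central)

lemma \<phi>_hom: "\<phi> (x + y) = \<phi> x + \<phi> y" "\<phi> (x - y) = \<phi> x - \<phi> y" "\<phi> (- x) = - \<phi> x" "\<phi> 0 = 0"
  "\<phi> (scale r x) = scale r (\<phi> x)"
  using lie unfolding lie_n_derivation_def
  by (auto intro: module_hom.add module_hom.diff module_hom.neg module_hom.zero module_hom.scale)

lemma sign_cancel: "(-1) ^ k * x = (-1) ^ k * y \<Longrightarrow> x = (y::'a)"
  by (cases "even k") simp_all

lemma diag_commutator_fe:
  assumes a: "corner e e a" and b: "corner f f b"
  shows "f * commutator (a - b) y * e = - (b * (f * y * e)) - f * y * e * a"
proof -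
  have "f * ((a - b) * y) * e = - (b * (f * y * e))"
  proof -
    have "f * ((a - b) * y) = - (b * y)"
      using corner_left(2)[OF a] corner_left(3)[OF b]
      by (simp add: left_diff_distrib right_diff_distrib flip: mult.assoc)
    also have "\<dots> = - (b * (f * y))" using corner_right(3)[OF b] by (simp flip: mult.assoc)
    finally show ?thesis by (simp add: mult.assoc)
  qed
  moreover have "f * (y * (a - b)) * e = f * y * e * a"
  proof -
    have "(a - b) * e = a"
      using corner_right(1)[OF a] corner_right(4)[OF b] by (simp add: left_diff_distrib)
    then have "f * (y * (a - b)) * e = f * y * a" by (simp add: mult.assoc)
    also have "\<dots> = f * y * e * a" using corner_left(1)[OF a] by (simp add: mult.assoc)
    finally show ?thesis .
  qed
  ultimately show ?thesis
    by (simp add: commutator_def left_diff_distrib right_diff_distrib)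
qed

lemma \<phi>_sign: "\<phi> ((-1) ^ k * x) = (-1) ^ k * \<phi> x"
  by (cases "even k") (simp_all add: \<phi>_hom)

lemma \<phi>_single: "\<phi> (iter_ad (n - 1) e x) = iter_ad (n - 1) e (\<phi> x)"
  using lie_n_derivation_padded[OF lie \<phi>_e_central n_ge_2, of 1 "\<lambda>_. x"] n_ge_2 by simp

lemma \<phi>_commutator:
  "\<phi> (iter_ad (n - 2) e (commutator x y))
     = iter_ad (n - 2) e (commutator (\<phi> x) y + commutator x (\<phi> y))"
proof -
  have "{1..2::nat} = {1, 2}" by auto
  then show ?thesis
    using lie_n_derivation_padded[OF lie \<phi>_e_central n_ge_2, of 2 "(\<lambda>_. x)(2 := y)"] n_ge_2
    by (simp add: numeral_2_eq_2 iter_ad_add)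
qed

lemma \<phi>_double_commutator:
  assumes "3 \<le> n"
  shows "\<phi> (iter_ad (n - 3) e (commutator (commutator x y) z))
     = iter_ad (n - 3) e (commutator (commutator (\<phi> x) y + commutator x (\<phi> y)) z
         + commutator (commutator x y) (\<phi> z))"
proof -
  have "{1..3::nat} = {1, 2, 3}" by auto
  moreover have "commutator (u + v) z = commutator u z + commutator v z" for u v z :: 'a
    by (simp add: commutator_def algebra_simps)
  ultimately show ?thesis
    using lie_n_derivation_padded[OF lie \<phi>_e_central n_ge_2, of 3 "(\<lambda>_. x)(2 := y, 3 := z)"] assms
    by (simp add: numeral_2_eq_2 numeral_3_eq_3 iter_ad_add)
qed

text \<open>Bracketing \<open>m\<close> with \<open>n - 1\<close> copies of \<open>e\<close> multiplies it by \<open>(-1)\<^sup>n\<^sup>-\<^sup>1\<close>.  Doing so with \<open>\<phi> m\<close> kills the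
  diagonal components and fixes the \<open>fAe\<close>-component, so for even \<open>n\<close> that component equals
  its own negative.\<close>

lemma \<phi>_single_ef:
  assumes m: "corner e f m"
  shows "e * \<phi> m * e = 0" "f * \<phi> m * f = 0" "even n \<Longrightarrow> f * \<phi> m * e = 0"
proof -
  define s :: 'a where "s = (-1) ^ (n - 1)"
  have s: "s = 1 \<or> s = -1" by (cases "even (n - 1)") (simp_all add: s_def)
  have eq: "s * \<phi> m = iter_ad (n - 1) e (\<phi> m)"
    using \<phi>_single[of m] iter_ad_ef[OF m, of "n - 1"] \<phi>_sign[of "n - 1" m] by (simp add: s_def)
  have "n - 1 \<ge> 1" using n_ge_2 by simp
  note pos = iter_ad_pos_compress[OF this, of "\<phi> m", folded eq]
  show "e * \<phi> m * e = 0" "f * \<phi> m * f = 0" using pos s by auto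
  show "f * \<phi> m * e = 0" if "even n"
  proof -
    have "s = -1" using that n_ge_2 by (simp add: s_def)
    then have "- (f * \<phi> m * e) = f * \<phi> m * e"
      using iter_ad_compress(2)[of "n - 1" "\<phi> m", folded eq] by simp
    then have "f * \<phi> m * e + f * \<phi> m * e = 0" by (metis add.left_inverse)
    then show ?thesis by (rule two)
  qed
qed

lemma \<phi>_diag: "corner e e a \<Longrightarrow> e * \<phi> a * f = 0" "corner e e a \<Longrightarrow> f * \<phi> a * e = 0"
proof -
  assume a: "corner e e a"
  have "iter_ad (n - 1) e a = 0"
    using a n_ge_2 by (intro iter_ad_diag) (simp_all add: corner_simps)
  then have 0: "iter_ad (n - 1) e (\<phi> a) = 0" using \<phi>_single[of a] by (simp add: \<phi>_hom)
  show "f * \<phi> a * e = 0" using iter_ad_compress(2)[of "n - 1" "\<phi> a"] 0 by simp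
  have "(-1) ^ (n - 1) * (e * \<phi> a * f) = (-1) ^ (n - 1) * 0"
    using iter_ad_compress(1)[of "n - 1" "\<phi> a"] 0 by simp
  then show "e * \<phi> a * f = 0" by (rule sign_cancel)
qed

text \<open>For odd \<open>n\<close>, bracketing with \<open>e\<close> an even number of times does not separate \<open>eAf\<close> from
  \<open>fAe\<close>, so the component \<open>g m = f \<phi>(m) e\<close> needs an argument of its own.  It is a twisted
  bimodule map, \<open>g (a m b) = b (g m) a\<close>, so that \<open>g (m t m')\<close> can be computed in two ways; together
  with the expansion of \<open>\<phi> [m, t, m', e, \<dots>, e]\<close> this shows that \<open>(g m) m' - m' (g m)\<close> is central
  and that \<open>m (g m) = 0 = (g m) m\<close>.  A central element killed by \<open>m \<noteq> 0\<close> vanishes.\<close>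

lemma \<phi>_ef_fe_component_odd:
  assumes odd: "odd n" and m0: "corner e f m0"
  shows "f * \<phi> m0 * e = 0"
proof -
  define g where "g m = f * \<phi> m * e" for m
  have g: "corner f e (g m)" for m by (simp add: g_def corner_compress)
  have g_add: "g (x + y) = g x + g y" for x y by (simp add: g_def \<phi>_hom algebra_simps)
  have n3: "3 \<le> n" using odd n_ge_2 by (cases "n = 2") auto
  then have "odd (n - 2)" "even (n - 3)" using odd by simp_all
  then have s: "(-1) ^ (n - 2) = (-1::'a)" "(-1) ^ (n - 3) = (1::'a)" by simp_all
  have gc: "g (commutator x y) = - (f * (commutator (\<phi> x) y + commutator x (\<phi> y)) * e)"
    if "corner e f (commutator x y)" for x y
  proof -
    have "- \<phi> (commutator x y) = iter_ad (n - 2) e (commutator (\<phi> x) y + commutator x (\<phi> y))"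
      using \<phi>_commutator[of x y] iter_ad_ef[OF that, of "n - 2"] by (simp add: s \<phi>_hom)
    then have "f * (- \<phi> (commutator x y)) * e = f * (commutator (\<phi> x) y + commutator x (\<phi> y)) * e"
      using iter_ad_compress(2) by metis
    then show ?thesis unfolding g_def by (metis minus_minus mult_minus_left mult_minus_right)
  qed
  have ga: "g (a * m) = g m * a" if a: "corner e e a" and m: "corner e f m" for a m
  proof -
    have "commutator a m = a * m" using a m by (simp add: commutator_def corner_orth)
    then show ?thesis using gc[of a m] corner_mult(1)[OF a m] a m
      by (simp add: g_def commutator_def algebra_simps corner_simps flip: mult.assoc)
        (simp add: mult.assoc corner_simps)
  qed
  have gb: "g (m * b) = b * g m" if b: "corner f f b" and m: "corner e f m" for b m
  proof -
    have "commutator m b = m * b" using b m by (simp add: commutator_def corner_orth)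
    then show ?thesis using gc[of m b] corner_mult(2)[OF m b] b m
      by (simp add: g_def commutator_def algebra_simps corner_simps flip: mult.assoc)
        (simp add: mult.assoc corner_simps)
  qed
  \<comment> \<open>\<open>m t m'\<close> read as \<open>(m t) m'\<close> and as \<open>m (t m')\<close>\<close>
  have twice: "g m' * (m * t) = t * m' * g m"
    if "corner e f m" "corner f e t" "corner e f m'" for m t m'
    using ga[OF corner_mult(2)[OF that(1,2)] that(3)] gb[OF corner_mult(1)[OF that(2,3)] that(1)]
    by (simp add: mult.assoc)
  \<comment> \<open>\<open>[[m, t], m'] = m t m' + m' t m\<close>, and \<open>g\<close> of this element, evaluated by the bimodule
    rule, is the negative of what the expansion gives.\<close>
  have triple: "g m' * (m * t) + t * m * g m' = 0"
    if m: "corner e f m" and t: "corner f e t" and m': "corner e f m'" for m t m'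
  proof -
    have mt: "corner e e (m * t)" "corner f f (t * m)" using m t by (simp_all add: corner_mult)
    define u where "u = m * t * m' + m' * (t * m)"
    have u: "corner e f u"
      using mt m' by (auto simp: u_def intro: corner_add corner_mult)
    have [simp]: "m * m' = 0" "m' * m = 0" using m m' by (simp_all add: corner_orth)
    have cu: "commutator (commutator m t) m' = u"
      by (simp add: commutator_def u_def algebra_simps) (simp flip: mult.assoc)
    define v where "v = commutator (\<phi> m) t + commutator m (\<phi> t)"
    have "\<phi> u = iter_ad (n - 3) e (commutator v m' + commutator (commutator m t) (\<phi> m'))"
      using \<phi>_double_commutator[OF n3, of m t m'] iter_ad_ef[OF u, of "n - 3"]
      by (simp add: s cu v_def)
    then have "g u = f * (commutator v m' + commutator (commutator m t) (\<phi> m')) * e"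
      using iter_ad_compress(2) unfolding g_def by metis
    also have "\<dots> = f * (commutator (commutator m t) (\<phi> m')) * e"
      using m' by (simp add: commutator_def[of v] algebra_simps corner_simps)
        (simp add: corner_simps flip: mult.assoc)
    also have "commutator m t = m * t - t * m" by (simp add: commutator_def)
    also have "f * (commutator (m * t - t * m) (\<phi> m')) * e = - (t * m * g m') - g m' * (m * t)"
      unfolding g_def by (rule diag_commutator_fe[OF mt])
    finally have "g u = - (t * m * g m') - g m' * (m * t)" .
    moreover have "g u = g m' * (m * t) + t * m * g m'"
      unfolding u_def g_add using ga[OF mt(1) m'] gb[OF mt(2) m'] by simp
    ultimately have "(g m' * (m * t) + t * m * g m') + (g m' * (m * t) + t * m * g m') = 0"
      by (simp add: algebra_simps)
    then show ?thesis by (rule two)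
  qed
  interpret s: peirce_prime scale f e by (rule swap)
  have mg: "m * g m = 0" if m: "corner e f m" for m
  proof (rule s.corner_f_faithful)
    fix t assume t: "corner f e t"
    have "t * m * g m + t * m * g m = 0" using triple[OF m t m] twice[OF m t m] by simp
    then have "t * m * g m = 0" by (rule two)
    then show "t * (m * g m) = 0" by (simp add: mult.assoc)
  qed (use m g in \<open>auto intro: corner_mult\<close>)
  have gm: "g m * m = 0" if m: "corner e f m" for m
  proof (rule s.corner_e_faithful)
    fix t assume t: "corner f e t"
    show "g m * m * t = 0" using triple[OF m t m] mg[OF m] by (simp add: mult.assoc)
  qed (use m g in \<open>auto intro: corner_mult\<close>)
  have central: "g m * m' - m' * g m \<in> centre UNIV" if m: "corner e f m" and m': "corner e f m'" for m m'
  proof -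
    have "g m * m' + - (m' * g m) \<in> centre UNIV"
    proof (rule s.centre_criterion)
      fix t assume "corner f e t"
      from triple[OF m' this m] show "g m * m' * t = t * - (m' * g m)"
        by (simp add: mult.assoc eq_neg_iff_add_eq_0)
    qed (use m' g in \<open>auto intro: corner_mult corner_uminus\<close>)
    then show ?thesis by simp
  qed
  show ?thesis
  proof (cases "m0 = 0")
    case True
    then show ?thesis by (simp add: \<phi>_hom)
  next
    case False
    have "g m0 = 0"
    proof (rule corner_f_faithful)
      fix m' assume m': "corner e f m'"
      define z where "z = g m0 * m' - m' * g m0"
      have "z * m0 = g m0 * (m' * m0) - m' * (g m0 * m0)"
        by (simp add: z_def algebra_simps)
      then have "z * m0 = 0" using m' m0 gm by (simp add: corner_orth)
      then have "z = 0" using centre_regular central m0 m' False unfolding z_def by blast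
      moreover have "m' * g m0 = - (e * z)"
        using corner_mult(1)[OF g[of m0] m'] corner_mult(2)[OF m' g[of m0]]
        by (simp add: z_def right_diff_distrib corner_simps)
      ultimately show "m' * g m0 = 0" by simp
    qed (rule g)
    then show ?thesis by (simp add: g_def)
  qed
qed

lemma \<phi>_corner_ef: assumes "corner e f m" shows "corner e f (\<phi> m)"
  using peirce_decomposition[of "\<phi> m"] \<phi>_single_ef[OF assms] \<phi>_ef_fe_component_odd[OF _ assms]
  by (cases "even n") (simp_all add: corner_def)

lemma \<phi>_corner_fe: assumes "corner f e t" shows "corner f e (\<phi> t)"
  by (rule normalised_lie_derivation.\<phi>_corner_ef[OF swap_normalised assms])

lemma \<phi>_commutator_ef:
  assumes "corner e f (commutator x y)" "corner e f (commutator (\<phi> x) y + commutator x (\<phi> y))"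
  shows "\<phi> (commutator x y) = commutator (\<phi> x) y + commutator x (\<phi> y)"
  using \<phi>_commutator[of x y] iter_ad_ef[OF assms(1)] iter_ad_ef[OF assms(2)] \<phi>_sign sign_cancel
  by metis

end

section \<open>The diagonal corners and their central components\<close>

context normalised_lie_derivation
begin

lemma \<phi>_diag_ff: "corner f f b \<Longrightarrow> e * \<phi> b * f = 0" "corner f f b \<Longrightarrow> f * \<phi> b * e = 0"
  using normalised_lie_derivation.\<phi>_diag[OF swap_normalised] by blast+

lemma \<phi>_ee_split: "corner e e a \<Longrightarrow> \<phi> a = e * \<phi> a * e + f * \<phi> a * f"
  using peirce_decomposition[of "\<phi> a"] \<phi>_diag by simp

lemma \<phi>_ff_split: "corner f f b \<Longrightarrow> \<phi> b = e * \<phi> b * e + f * \<phi> b * f"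
  using peirce_decomposition[of "\<phi> b"] \<phi>_diag_ff by simp

lemma \<phi>_ee_ef:
  assumes a: "corner e e a" and m: "corner e f m"
  shows "\<phi> (a * m) = e * \<phi> a * e * m - m * (f * \<phi> a * f) + a * \<phi> m"
proof -
  have am: "commutator a m = a * m" using a m by (simp add: commutator_def corner_orth)
  have 1: "commutator (\<phi> a) m = e * \<phi> a * e * m - m * (f * \<phi> a * f)"
    using corner_orth(2)[OF corner_compress(4) m] corner_orth(2)[OF m corner_compress(1)]
    by (subst \<phi>_ee_split[OF a]) (simp add: commutator_def distrib_left distrib_right)
  have 2: "commutator a (\<phi> m) = a * \<phi> m"
    using a \<phi>_corner_ef[OF m] by (simp add: commutator_def corner_orth)
  have "\<phi> (commutator a m) = commutator (\<phi> a) m + commutator a (\<phi> m)"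
    by (rule \<phi>_commutator_ef; unfold 1 2 am)
      (use a m \<phi>_corner_ef[OF m] in \<open>auto intro!: corner_add corner_diff
        intro: corner_mult corner_compress\<close>)
  then show ?thesis by (simp only: 1 2 am)
qed

lemma \<phi>_fe_ee:
  assumes t: "corner f e t" and a: "corner e e a"
  shows "\<phi> (t * a) = \<phi> t * a + t * (e * \<phi> a * e) - f * \<phi> a * f * t"
proof -
  have ta: "commutator t a = t * a" using a t by (simp add: commutator_def corner_orth)
  have 1: "commutator t (\<phi> a) = t * (e * \<phi> a * e) - f * \<phi> a * f * t"
    using corner_orth(1)[OF corner_compress(1) t] corner_orth(1)[OF t corner_compress(4)]
    by (subst \<phi>_ee_split[OF a]) (simp add: commutator_def distrib_left distrib_right)
  have 2: "commutator (\<phi> t) a = \<phi> t * a"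
    using a \<phi>_corner_fe[OF t] by (simp add: commutator_def corner_orth)
  have c: "corner f e (t * a)" "corner f e (\<phi> t * a + (t * (e * \<phi> a * e) - f * \<phi> a * f * t))"
    using a t \<phi>_corner_fe[OF t] by (auto intro!: corner_add corner_diff
        intro: corner_mult corner_compress)
  show ?thesis using \<phi>_commutator[of t a] iter_ad_fe[OF c(1)] iter_ad_fe[OF c(2)]
    by (simp add: 1 2 ta add_diff_eq)
qed

lemma \<phi>_ff_fe:
  assumes "corner f f b" and "corner f e t"
  shows "\<phi> (b * t) = f * \<phi> b * f * t - t * (e * \<phi> b * e) + b * \<phi> t"
  using normalised_lie_derivation.\<phi>_ee_ef[OF swap_normalised assms] .

lemma \<phi>_ef_ff:
  assumes "corner e f m" and "corner f f b"
  shows "\<phi> (m * b) = \<phi> m * b + m * (f * \<phi> b * f) - e * \<phi> b * e * m"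
  using normalised_lie_derivation.\<phi>_fe_ee[OF swap_normalised assms] .

text \<open>For \<open>c = e \<phi>(b) e\<close>, the commutators \<open>[a, c]\<close> with \<open>a \<in> eAe\<close> are all \<open>e\<close> times central
  elements.  So is \<open>[a c, c] = [a, c] c\<close>, which therefore commutes with \<open>a\<close>.  With
  \<open>[a, c] = e z\<close> this means \<open>z [a, c] = 0\<close>, and central elements of a prime algebra are
  either zero or regular.\<close>

lemma ee_part_central:
  assumes b: "corner f f b" and a: "corner e e a"
  shows "a * (e * \<phi> b * e) = e * \<phi> b * e * a"
proof -
  define c where "c = e * \<phi> b * e"
  have c: "corner e e c" by (simp add: c_def corner_compress)
  have central: "\<exists>z\<in>centre UNIV. commutator x c = e * z" if x: "corner e e x" for x
  proof -
    define u where "u = commutator (\<phi> x) b + commutator x (\<phi> b)"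
    have 1: "commutator (\<phi> x) b = commutator (f * \<phi> x * f) b"
      using corner_orth(1)[OF corner_compress(1) b] corner_orth(2)[OF b corner_compress(1)]
      by (subst \<phi>_ee_split[OF x]) (simp add: commutator_def distrib_left distrib_right)
    have 2: "commutator x (\<phi> b) = commutator x c"
      using corner_orth(1)[OF x corner_compress(4)] corner_orth(2)[OF corner_compress(4) x]
      by (subst \<phi>_ff_split[OF b]) (simp add: commutator_def distrib_left distrib_right c_def)
    have c1: "corner f f (commutator (f * \<phi> x * f) b)"
      unfolding commutator_def using b by (auto intro!: corner_diff intro: corner_mult corner_compress)
    have c2: "corner e e (commutator x c)"
      unfolding commutator_def using x c by (auto intro!: corner_diff intro: corner_mult)
    have xb: "commutator x b = 0"
      using corner_orth(1)[OF x b] corner_orth(2)[OF b x] by (simp add: commutator_def)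
    \<comment> \<open>Since \<open>[x, b] = 0\<close>, already \<open>u = 0\<close> for \<open>n = 2\<close>.  For larger \<open>n\<close> the remaining slots are
      filled with some \<open>m \<in> eAf\<close> and copies of \<open>e\<close>, which shows that \<open>u\<close> commutes with \<open>eAf\<close>.\<close>
    have "u \<in> centre UNIV"
    proof (cases "n = 2")
      case True
      then have "u = 0" using \<phi>_commutator[of x b] xb by (simp add: u_def \<phi>_hom)
      then show ?thesis by (simp add: centre_0)
    next
      case False
      then have n3: "3 \<le> n" using n_ge_2 by simp
      have "commutator x c + commutator (f * \<phi> x * f) b \<in> centre UNIV"
      proof (rule centre_criterion[OF c2 c1])
        fix m assume m: "corner e f m"
        have eq: "commutator u m = commutator x c * m - m * commutator (f * \<phi> x * f) b"
          unfolding u_def 1 2 using corner_orth(2)[OF m c2] corner_orth(2)[OF c1 m]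
          by (simp add: commutator_def[of _ m] distrib_left distrib_right)
        have um: "corner e f (commutator u m)"
          unfolding eq using m c1 c2 by (auto intro!: corner_diff intro: corner_mult)
        have "commutator (0::'a) y = 0" for y by (simp add: commutator_def)
        moreover have "iter_ad (n - 3) e 0 = 0" using iter_ad_ef[OF corner_0] by simp
        ultimately have "iter_ad (n - 3) e (commutator u m) = 0"
          using \<phi>_double_commutator[OF n3, of x b m] by (simp add: xb u_def \<phi>_hom)
        then have "(-1) ^ (n - 3) * commutator u m = (-1) ^ (n - 3) * 0"
          using iter_ad_ef[OF um] by simp
        then have "commutator u m = 0" by (rule sign_cancel)
        then show "commutator x c * m = m * commutator (f * \<phi> x * f) b" using eq by simp
      qed
      then show ?thesis by (simp add: u_def 1 2 add.commute)
    qed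
    moreover have "commutator x c = e * u"
      unfolding u_def 1 2 using c1 c2 by (simp add: distrib_left corner_simps)
    ultimately show ?thesis by blast
  qed
  obtain z where z: "z \<in> centre UNIV" "commutator a c = e * z" using central[OF a] by blast
  obtain z' where z': "z' \<in> centre UNIV" "commutator (a * c) c = e * z'"
    using central corner_mult(1)[OF a c] by blast
  have zx: "x * z = z * x" "x * z' = z' * x" for x using z(1) z'(1) by (simp_all add: centre_UNIV_iff)
  have "e * z' = commutator a c * c" by (simp add: z'(2)[symmetric] commutator_def algebra_simps)
  also have "\<dots> = z * c" using c by (simp add: z(2) zx corner_simps mult.assoc)
  finally have zc: "z * c = e * z'" ..
  have "z * (a * c) = a * (z * c)" using zx(1)[of a] by (metis mult.assoc)
  also have "\<dots> = a * z'" using corner_right(1)[OF a] by (simp add: zc flip: mult.assoc)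
  also have "\<dots> = e * (a * z')" using corner_left(1)[OF a] by (simp flip: mult.assoc)
  also have "\<dots> = z * c * a" by (simp add: zc zx(2)[of a] mult.assoc)
  finally have "z * commutator a c = 0" by (simp add: commutator_def right_diff_distrib mult.assoc)
  then have "z = 0 \<or> commutator a c = 0" using centre_regular z(1) by blast
  then have "commutator a c = 0" using z(2) by auto
  then show ?thesis by (simp add: commutator_def c_def)
qed

lemma ff_part_central:
  assumes "corner e e a" and "corner f f b"
  shows "b * (f * \<phi> a * f) = f * \<phi> a * f * b"
  using normalised_lie_derivation.ee_part_central[OF swap_normalised assms] .

text \<open>A summand \<open>\<tau>\<close> with central values that leaves \<open>\<phi> - \<tau>\<close> preserving \<open>eAe\<close> must
  satisfy \<open>f \<tau>(a) = f \<phi>(a) f\<close> for \<open>a \<in> eAe\<close>.  The predicate records that such a value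
  exists at \<open>a\<close>.\<close>

definition ff_part_extends :: "'a \<Rightarrow> bool" where
  "ff_part_extends a \<longleftrightarrow> (\<exists>z\<in>centre UNIV. f * z = f * \<phi> a * f)"

lemma ff_part_extendsI:
  assumes "corner e e \<alpha>" and "\<And>m. corner e f m \<Longrightarrow> \<alpha> * m = m * (f * \<phi> a * f)"
  shows "ff_part_extends a"
proof -
  have "\<alpha> + f * \<phi> a * f \<in> centre UNIV"
    by (rule centre_criterion) (use assms in \<open>auto simp: corner_compress\<close>)
  moreover have "f * (\<alpha> + f * \<phi> a * f) = f * \<phi> a * f"
    using assms(1) by (simp add: distrib_left corner_simps mult.assoc)
  ultimately show ?thesis unfolding ff_part_extends_def by blast
qed

text \<open>The failure of \<open>a \<mapsto> e \<phi>(a) e\<close> to be a derivation of \<open>eAe\<close>, read off from the two ways of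
  expanding \<open>\<phi> ((a a') m) = \<phi> (a (a' m))\<close>.\<close>

lemma ee_defect:
  assumes a: "corner e e a" and a': "corner e e a'" and m: "corner e f m"
  shows "(e * \<phi> (a * a') * e - e * \<phi> a * e * a' - a * (e * \<phi> a' * e)) * m
       = m * (f * \<phi> (a * a') * f) - a' * m * (f * \<phi> a * f) - a * m * (f * \<phi> a' * f)"
proof -
  have "\<phi> (a * a' * m) = e * \<phi> (a * a') * e * m - m * (f * \<phi> (a * a') * f) + a * a' * \<phi> m"
    by (rule \<phi>_ee_ef[OF corner_mult(1)[OF a a'] m])
  moreover have "\<phi> (a * (a' * m)) = e * \<phi> a * e * (a' * m) - a' * m * (f * \<phi> a * f)
      + a * (e * \<phi> a' * e * m - m * (f * \<phi> a' * f) + a' * \<phi> m)"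
    by (simp add: \<phi>_ee_ef[OF a corner_mult(1)[OF a' m]] \<phi>_ee_ef[OF a' m])
  ultimately show ?thesis by (simp add: algebra_simps)
qed

text \<open>If \<open>f \<phi>(a) f = f z\<close> and \<open>f \<phi>(a') f = f z'\<close>, the correction terms in the defect are
  \<open>z a' m\<close> and \<open>z' a m\<close>, which act from the left.  So \<open>f \<phi>(a a') f\<close> acts on \<open>eAf\<close> from the right
  as some element of \<open>eAe\<close> does from the left.\<close>

lemma ff_part_extends_mult:
  assumes a: "corner e e a" "ff_part_extends a" and a': "corner e e a'" "ff_part_extends a'"
  shows "ff_part_extends (a * a')"
proof -
  obtain z z' where z: "z \<in> centre UNIV" "f * z = f * \<phi> a * f"
    and z': "z' \<in> centre UNIV" "f * z' = f * \<phi> a' * f"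
    using a a' by (auto simp: ff_part_extends_def)
  have zx: "x * z = z * x" "x * z' = z' * x" for x using z(1) z'(1) by (simp_all add: centre_UNIV_iff)
  have mz: "m * (f * \<phi> a * f) = z * m" "m * (f * \<phi> a' * f) = z' * m" if "corner e f m" for m
    using that by (simp_all add: corner_simps flip: z(2) z'(2) mult.assoc) (simp_all add: zx)
  show ?thesis
  proof (rule ff_part_extendsI)
    let ?D = "e * \<phi> (a * a') * e - e * \<phi> a * e * a' - a * (e * \<phi> a' * e)"
    have "corner e e (e * y)" if "y \<in> centre UNIV" for y
      using that by (simp add: centre_UNIV_iff corner_def mult.assoc)
    then have ez: "corner e e (e * z)" "corner e e (e * z')" using z z' by auto
    show "corner e e (?D + e * z * a' + e * z' * a)"
      using a a' ez by (auto intro!: corner_add corner_diff intro: corner_mult corner_compress)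
    fix m assume m: "corner e f m"
    have "e * z * a' * m = a' * m * (f * \<phi> a * f)" "e * z' * a * m = a * m * (f * \<phi> a' * f)"
      using mz(1)[OF corner_mult(1)[OF a'(1) m]] mz(2)[OF corner_mult(1)[OF a(1) m]] a(1) a'(1)
      by (simp_all add: zx corner_simps mult.assoc)
    then show "(?D + e * z * a' + e * z' * a) * m = m * (f * \<phi> (a * a') * f)"
      using ee_defect[OF a(1) a'(1) m] by (simp add: distrib_right)
  qed
qed

text \<open>Write \<open>\<beta> = f \<phi>(u) f\<close> and let \<open>D\<close> be the defect of the pair \<open>(u, u)\<close>, so that
  \<open>D m = m \<beta> - 2 u m \<beta>\<close>.  Replacing \<open>m\<close> by \<open>u m\<close> gives \<open>u m \<beta> = - D u m\<close>, whence
  \<open>m \<beta> = (D - 2 D u) m\<close>.\<close>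

lemma ff_part_extends_idempotent:
  assumes u: "corner e e u" and idem: "u * u = u"
  shows "ff_part_extends u"
proof -
  define D where "D = e * \<phi> (u * u) * e - e * \<phi> u * e * u - u * (e * \<phi> u * e)"
  define \<beta> where "\<beta> = f * \<phi> u * f"
  have D: "corner e e D"
    using u by (auto simp: D_def intro!: corner_diff intro: corner_mult corner_compress)
  have Dm: "D * m = m * \<beta> - u * m * \<beta> - u * m * \<beta>" if "corner e f m" for m
    using ee_defect[OF u u that] by (simp add: D_def \<beta>_def idem)
  show ?thesis
  proof (rule ff_part_extendsI)
    show "corner e e (D - D * u - D * u)" using D u by (auto intro!: corner_diff intro: corner_mult)
    fix m assume m: "corner e f m"
    have "u * (u * m) = u * m" by (simp add: idem flip: mult.assoc)
    then have "D * (u * m) = - (u * m * \<beta>)" using Dm[OF corner_mult(1)[OF u m]] by simp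
    then show "(D - D * u - D * u) * m = m * (f * \<phi> u * f)"
      using Dm[OF m] by (simp add: left_diff_distrib mult.assoc \<beta>_def)
  qed
qed

text \<open>The terms of the defect that involve \<open>f \<phi>(a) f\<close> and \<open>f \<phi>(a') f\<close> are symmetric in the pair
  and cancel in the commutator.\<close>

lemma ff_part_extends_commutator:
  assumes a: "corner e e a" and a': "corner e e a'"
  shows "ff_part_extends (commutator a a')"
proof -
  define D where "D x y = e * \<phi> (x * y) * e - e * \<phi> x * e * y - x * (e * \<phi> y * e)" for x y
  show ?thesis
  proof (rule ff_part_extendsI)
    show "corner e e (D a a' - D a' a)"
      using a a' by (auto simp: D_def intro!: corner_diff intro: corner_mult corner_compress)
    fix m assume m: "corner e f m"
    show "(D a a' - D a' a) * m = m * (f * \<phi> (commutator a a') * f)"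
      using ee_defect[OF a a' m] ee_defect[OF a' a m]
      unfolding D_def[symmetric] commutator_def \<phi>_hom
      by (simp add: left_diff_distrib right_diff_distrib)
  qed
qed

lemma ff_part_extends_subspace: "subspace {a. corner e e a \<and> ff_part_extends a}"
proof (rule subspaceI)
  show "0 \<in> {a. corner e e a \<and> ff_part_extends a}"
    by (auto simp: corner_0 ff_part_extends_def \<phi>_hom intro: bexI[OF _ centre_0])
next
  fix x y assume "x \<in> {a. corner e e a \<and> ff_part_extends a}" "y \<in> {a. corner e e a \<and> ff_part_extends a}"
  moreover from this obtain z z' where "z \<in> centre UNIV" "f * z = f * \<phi> x * f"
    "z' \<in> centre UNIV" "f * z' = f * \<phi> y * f" by (auto simp: ff_part_extends_def)
  ultimately show "x + y \<in> {a. corner e e a \<and> ff_part_extends a}"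
    by (auto simp: corner_add ff_part_extends_def \<phi>_hom distrib_left distrib_right
        intro!: bexI[OF _ centre_add])
next
  fix r x assume "x \<in> {a. corner e e a \<and> ff_part_extends a}"
  moreover from this obtain z where "z \<in> centre UNIV" "f * z = f * \<phi> x * f"
    by (auto simp: ff_part_extends_def)
  ultimately show "scale r x \<in> {a. corner e e a \<and> ff_part_extends a}"
    by (auto simp: corner_def centre_UNIV_iff ff_part_extends_def \<phi>_hom scale_mult_left
        scale_mult_right intro!: bexI[of _ "scale r z"])
qed

lemma sandwich_ee: "sandwich e UNIV e = {x. corner e e x}"
  by (auto simp: sandwich_def corner_def mult.assoc) metis

lemma sandwich_ff: "sandwich f UNIV f = {x. corner f f x}"
  by (auto simp: sandwich_def corner_def mult.assoc) metis

text \<open>In the first case the elements of \<open>eAe\<close> that extend form a subalgebra containing all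
  generators.  In the second, \<open>f \<phi>(a) f\<close> is central in \<open>fAf\<close> for every \<open>a \<in> eAe\<close>, and
  the hypothesis supplies the extension.\<close>

lemma ff_part_extends:
  assumes alt: "sandwich e UNIV e = idem_comm_subalgebra scale (sandwich e UNIV e) \<or>
      centre (sandwich f UNIV f) = sandwich f (centre UNIV) f"
    and a: "corner e e a"
  shows "ff_part_extends a"
  using alt
proof
  assume S: "sandwich e UNIV e = idem_comm_subalgebra scale (sandwich e UNIV e)"
  have "idem_comm_subalgebra scale (sandwich e UNIV e) \<subseteq> {a. corner e e a \<and> ff_part_extends a}"
    unfolding idem_comm_subalgebra_def
  proof (rule hull_minimal)
    have "corner e e (commutator x y)" if "corner e e x" "corner e e y" for x y
      using that by (auto simp: commutator_def intro!: corner_diff intro: corner_mult)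
    then show "{u \<in> sandwich e UNIV e. u * u = u} \<union>
        {commutator x y |x y. x \<in> sandwich e UNIV e \<and> y \<in> sandwich e UNIV e}
        \<subseteq> {a. corner e e a \<and> ff_part_extends a}"
      by (auto simp: sandwich_ee ff_part_extends_idempotent ff_part_extends_commutator)
    show "subalgebra scale (sandwich e UNIV e) {a. corner e e a \<and> ff_part_extends a}"
      unfolding subalgebra_def using ff_part_extends_subspace
      by (auto simp: sandwich_ee intro: corner_mult ff_part_extends_mult)
  qed
  then show ?thesis using S a by (auto simp: sandwich_ee)
next
  assume "centre (sandwich f UNIV f) = sandwich f (centre UNIV) f"
  moreover have "f * \<phi> a * f \<in> centre (sandwich f UNIV f)"
    by (auto simp: centre_def sandwich_ff corner_compress ff_part_central[OF a])
  ultimately obtain z where "z \<in> centre UNIV" "f * \<phi> a * f = f * z * f" by (auto simp: sandwich_def)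
  moreover from this have "f * z * f = f * z" by (simp add: centre_UNIV_iff mult.assoc)
  ultimately show ?thesis unfolding ff_part_extends_def by force
qed

end

section \<open>Extending the Leibniz rule from pairs of corners\<close>

text \<open>These are the properties that \<open>\<phi> - \<tau>\<close> can be seen to have directly.  The Leibniz rule for
  two elements of one diagonal corner, and for \<open>m t\<close> and \<open>t m\<close> separately, has to be deduced.\<close>

locale corner_derivation = peirce_prime scale e f
  for scale :: "'r::comm_ring_1 \<Rightarrow> 'a::ring_1 \<Rightarrow> 'a" and e f :: 'a +
  fixes h :: "'a \<Rightarrow> 'a"
  assumes h_add: "h (x + y) = h x + h y"
    and h_corner: "corner e e a \<Longrightarrow> corner e e (h a)" "corner e f m \<Longrightarrow> corner e f (h m)"
      "corner f e t \<Longrightarrow> corner f e (h t)" "corner f f b \<Longrightarrow> corner f f (h b)"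
    and ee_ef: "corner e e a \<Longrightarrow> corner e f m \<Longrightarrow> h (a * m) = h a * m + a * h m"
    and ef_ff: "corner e f m \<Longrightarrow> corner f f b \<Longrightarrow> h (m * b) = h m * b + m * h b"
    and fe_ee: "corner f e t \<Longrightarrow> corner e e a \<Longrightarrow> h (t * a) = h t * a + t * h a"
    and ff_fe: "corner f f b \<Longrightarrow> corner f e t \<Longrightarrow> h (b * t) = h b * t + b * h t"
    and ef_fe_central: "corner e f m \<Longrightarrow> corner f e t \<Longrightarrow>
      h (commutator m t) - commutator (h m) t - commutator m (h t) \<in> centre UNIV"
begin

lemma h_0: "h 0 = 0"
  using h_add[of 0 0] by simp

lemma h_diff: "h (x - y) = h x - h y"
  using h_add[of "x - y" y] by simp

lemma swap_corner_derivation: "corner_derivation scale f e h"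
proof (intro corner_derivation.intro swap corner_derivation_axioms.intro)
  fix m t assume "corner f e t" "corner e f m"
  then have "0 - (h (commutator m t) - commutator (h m) t - commutator m (h t)) \<in> centre UNIV"
    by (intro centre_diff centre_0 ef_fe_central)
  also have "0 - (h (commutator m t) - commutator (h m) t - commutator m (h t))
      = h (commutator t m) - commutator (h t) m - commutator t (h m)"
    by (simp add: commutator_def h_diff)
  finally show "h (commutator t m) - commutator (h t) m - commutator t (h m) \<in> centre UNIV" .
qed (fact h_add h_corner ee_ef ef_ff fe_ee ff_fe)+

text \<open>Expand \<open>h (a a' m)\<close> in two ways and use that \<open>eAf\<close> is a faithful left \<open>eAe\<close>-module.\<close>

lemma ee_ee:
  assumes a: "corner e e a" and a': "corner e e a'"
  shows "h (a * a') = h a * a' + a * h a'"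
proof -
  have "h (a * a') - (h a * a' + a * h a') = 0"
  proof (rule corner_e_faithful)
    show "corner e e (h (a * a') - (h a * a' + a * h a'))"
      using a a' h_corner(1) by (auto intro!: corner_diff corner_add intro: corner_mult)
    fix m assume m: "corner e f m"
    have "h (a * a' * m) = h (a * a') * m + a * a' * h m"
      by (rule ee_ef[OF corner_mult(1)[OF a a'] m])
    moreover have "h (a * (a' * m)) = h a * (a' * m) + a * (h a' * m + a' * h m)"
      by (simp add: ee_ef[OF a corner_mult(1)[OF a' m]] ee_ef[OF a' m])
    ultimately show "(h (a * a') - (h a * a' + a * h a')) * m = 0"
      by (simp add: algebra_simps)
  qed
  then show ?thesis by simp
qed

text \<open>Let \<open>\<epsilon>\<close> and \<open>\<epsilon>'\<close> be the defects of \<open>h\<close> on \<open>m t\<close> and \<open>t m\<close>.  Expanding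
  \<open>h (m t m)\<close> in two ways gives \<open>\<epsilon> m = m \<epsilon>'\<close>, while \<open>z = \<epsilon> - \<epsilon>'\<close> is central.
  Hence \<open>z m = \<epsilon> m = m \<epsilon>' = - m z\<close>, so \<open>2 z m = 0\<close> and either \<open>z\<close> or \<open>m\<close> vanishes.\<close>

lemma ef_fe:
  assumes m: "corner e f m" and t: "corner f e t"
  shows "h (m * t) = h m * t + m * h t"
proof -
  define \<epsilon> \<epsilon>' where "\<epsilon> = h (m * t) - h m * t - m * h t" and "\<epsilon>' = h (t * m) - h t * m - t * h m"
  have \<epsilon>: "corner e e \<epsilon>" and \<epsilon>': "corner f f \<epsilon>'"
    using m t h_corner(2)[OF m] h_corner(3)[OF t] h_corner(1)[OF corner_mult(2)[OF m t]]
      h_corner(4)[OF corner_mult(1)[OF t m]]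
    by (auto simp: \<epsilon>_def \<epsilon>'_def intro!: corner_diff intro: corner_mult)
  define z where "z = \<epsilon> - \<epsilon>'"
  have "z = h (commutator m t) - commutator (h m) t - commutator m (h t)"
    by (simp add: z_def \<epsilon>_def \<epsilon>'_def commutator_def h_diff)
  then have z: "z \<in> centre UNIV" using ef_fe_central[OF m t] by simp
  have "h (m * t * m) = h (m * t) * m + m * t * h m"
    by (rule ee_ef[OF corner_mult(2)[OF m t] m])
  moreover have "h (m * (t * m)) = h m * (t * m) + m * h (t * m)"
    by (rule ef_ff[OF m corner_mult(1)[OF t m]])
  ultimately have "\<epsilon> * m = m * \<epsilon>'"
    by (simp add: \<epsilon>_def \<epsilon>'_def algebra_simps)
  moreover have "z * m = \<epsilon> * m" using corner_orth(2)[OF \<epsilon>' m] by (simp add: z_def left_diff_distrib)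
  moreover have "m * z = - (m * \<epsilon>')" using corner_orth(2)[OF m \<epsilon>] by (simp add: z_def right_diff_distrib)
  moreover have "m * z = z * m" using z by (simp add: centre_UNIV_iff)
  ultimately have "z * m = - (z * m)" by simp
  then have "z * m + z * m = 0" by (metis add.right_inverse)
  then have "z * m = 0" by (rule two)
  then consider "z = 0" | "m = 0" using centre_regular[OF z] by blast
  then have "\<epsilon> = 0"
  proof cases
    case 1
    then have "\<epsilon> = \<epsilon>'" by (simp add: z_def)
    then show ?thesis using corner_left(1)[OF \<epsilon>] corner_left(4)[OF \<epsilon>'] by simp
  next
    case 2
    then show ?thesis by (simp add: \<epsilon>_def h_0)
  qed
  then show ?thesis by (simp add: \<epsilon>_def algebra_simps)
qed

lemma leibniz_sum_right:
  assumes "\<And>y. corner e e y \<Longrightarrow> h (x * y) = h x * y + x * h y"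
    and "\<And>y. corner e f y \<Longrightarrow> h (x * y) = h x * y + x * h y"
    and "\<And>y. corner f e y \<Longrightarrow> h (x * y) = h x * y + x * h y"
    and "\<And>y. corner f f y \<Longrightarrow> h (x * y) = h x * y + x * h y"
  shows "h (x * y) = h x * y + x * h y"
proof -
  have sum: "h (x * (u + v)) = h x * (u + v) + x * h (u + v)"
    if "h (x * u) = h x * u + x * h u" "h (x * v) = h x * v + x * h v" for u v
    using that by (simp add: h_add distrib_left)
  show ?thesis
    by (subst (1 2 3) peirce_decomposition[of y]) (intro sum assms corner_compress)
qed

lemma leibniz_left_e:
  assumes "corner e q x" "q = e \<or> q = f"
  shows "h (x * y) = h x * y + x * h y"
  using assms(2)
proof
  assume "q = e"
  then have x: "corner e e x" "corner e e (h x)" using assms h_corner by auto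
  show ?thesis
    by (rule leibniz_sum_right)
      (use x in \<open>auto simp: ee_ee ee_ef corner_orth(1)[OF x(1)]
        corner_orth(1)[OF x(2)] corner_orth(1)[OF x(1) h_corner(3)]
        corner_orth(1)[OF x(1) h_corner(4)] h_0\<close>)
next
  assume "q = f"
  then have x: "corner e f x" "corner e f (h x)" using assms h_corner by auto
  show ?thesis
    by (rule leibniz_sum_right)
      (use x in \<open>auto simp: ef_fe ef_ff corner_orth(2)[OF x(1)]
        corner_orth(2)[OF x(2)] corner_orth(2)[OF x(1) h_corner(1)]
        corner_orth(2)[OF x(1) h_corner(2)] h_0\<close>)
qed

lemma leibniz: "h (x * y) = h x * y + x * h y"
proof -
  note f = corner_derivation.leibniz_left_e[OF swap_corner_derivation]
  have sum: "h ((u + v) * y) = h (u + v) * y + (u + v) * h y"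
    if "h (u * y) = h u * y + u * h y" "h (v * y) = h v * y + v * h y" for u v
    using that by (simp add: h_add distrib_right)
  show ?thesis
    by (subst (1 2 3) peirce_decomposition[of x])
      (intro sum leibniz_left_e[OF corner_compress(1)] leibniz_left_e[OF corner_compress(2)]
        f[OF corner_compress(3)] f[OF corner_compress(4)]; simp)
qed

end

section \<open>The standard form\<close>

context normalised_lie_derivation
begin

text \<open>Once the components \<open>f \<phi>(eae) f\<close> and \<open>e \<phi>(faf) e\<close> extend to central elements of the whole
  algebra, these elements form the central summand \<open>\<tau>\<close>.  They are unique, since no nonzero
  central element is killed by \<open>e\<close> or \<open>f\<close>, and so depend linearly on the argument.\<close>

lemma standard_if_extends:
  assumes ext_f: "\<And>a. corner e e a \<Longrightarrow> \<exists>z\<in>centre UNIV. f * z = f * \<phi> a * f"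
    and ext_e: "\<And>b. corner f f b \<Longrightarrow> \<exists>z\<in>centre UNIV. e * z = e * \<phi> b * e"
  shows "\<exists>h \<tau>. derivation scale h \<and> module_hom scale scale \<tau> \<and> range \<tau> \<subseteq> centre UNIV \<and>
    (\<forall>a. \<phi> a = h a + \<tau> a)"
proof -
  have linear_choice: "\<exists>\<sigma>. (\<forall>x. \<sigma> x \<in> centre UNIV \<and> p * \<sigma> x = p * \<phi> (q * x * q) * p) \<and>
      module_hom scale scale \<sigma>"
    if p: "p \<noteq> 0" and ext: "\<And>x. \<exists>z\<in>centre UNIV. p * z = p * \<phi> (q * x * q) * p" for p q
  proof -
    obtain \<sigma> where \<sigma>: "\<And>x. \<sigma> x \<in> centre UNIV" "\<And>x. p * \<sigma> x = p * \<phi> (q * x * q) * p"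
      using ext by metis
    have unique: "y = z" if "y \<in> centre UNIV" "z \<in> centre UNIV" "p * y = p * z" for y z
    proof -
      have "(y - z) * p = p * (y - z)" using centre_diff[OF that(1,2)] by (simp add: centre_UNIV_iff)
      also have "\<dots> = 0" using that(3) by (simp add: right_diff_distrib)
      finally show ?thesis using centre_regular[OF centre_diff[OF that(1,2)]] p by auto
    qed
    have "module_hom scale scale \<sigma>"
    proof (intro module_hom.intro module_axioms module_hom_axioms.intro)
      fix x y
      show "\<sigma> (x + y) = \<sigma> x + \<sigma> y"
        by (rule unique) (simp_all add: \<sigma> centre_add \<phi>_hom distrib_left distrib_right)
    next
      fix r x
      have "scale r (\<sigma> x) \<in> centre UNIV"
        using \<sigma>(1)[of x] by (simp add: centre_UNIV_iff scale_mult_left scale_mult_right)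
      then show "\<sigma> (scale r x) = scale r (\<sigma> x)"
        by (intro unique[OF \<sigma>(1)]) (simp_all add: \<sigma> \<phi>_hom scale_mult_left scale_mult_right)
    qed
    with \<sigma> show ?thesis by blast
  qed
  obtain \<tau>1 where \<tau>1: "\<And>x. \<tau>1 x \<in> centre UNIV" "\<And>x. f * \<tau>1 x = f * \<phi> (e * x * e) * f"
    "module_hom scale scale \<tau>1"
    using linear_choice[OF f_nonzero ext_f[OF corner_compress(1)]] by blast
  obtain \<tau>2 where \<tau>2: "\<And>x. \<tau>2 x \<in> centre UNIV" "\<And>x. e * \<tau>2 x = e * \<phi> (f * x * f) * e"
    "module_hom scale scale \<tau>2"
    using linear_choice[OF e_nonzero ext_e[OF corner_compress(4)]] by blast
  define \<tau> where "\<tau> x = \<tau>1 x + \<tau>2 x" for x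
  define h where "h x = \<phi> x - \<tau> x" for x
  interpret p: module_pair scale scale by unfold_locales
  have \<tau>_hom: "module_hom scale scale \<tau>"
    unfolding \<tau>_def by (intro p.module_hom_add \<tau>1 \<tau>2)
  have \<tau>_central: "\<tau> x \<in> centre UNIV" for x
    unfolding \<tau>_def by (intro centre_add \<tau>1 \<tau>2)
  have h_hom: "module_hom scale scale h"
    unfolding h_def using lie \<tau>_hom by (intro p.module_hom_sub) (simp_all add: lie_n_derivation_def)
  have killed_f: "z = 0" if "z \<in> centre UNIV" "f * z = 0" for z
    using centre_regular[OF that(1), of f] that f_nonzero by (simp add: centre_UNIV_iff)
  have killed_e: "z = 0" if "z \<in> centre UNIV" "e * z = 0" for z
    using centre_regular[OF that(1), of e] that e_nonzero by (simp add: centre_UNIV_iff)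
  have \<tau>1_0: "\<tau>1 x = 0" if "e * x * e = 0" for x
    by (rule killed_f) (simp_all add: \<tau>1 that \<phi>_hom)
  have \<tau>2_0: "\<tau>2 x = 0" if "f * x * f = 0" for x
    by (rule killed_e) (simp_all add: \<tau>2 that \<phi>_hom)
  have \<tau>_ee: "f * \<tau> a = f * \<phi> a * f" if a: "corner e e a" for a
    using \<tau>2_0[of a] \<tau>1(2)[of a] a by (simp_all add: \<tau>_def corner_simps)
  have \<tau>_ff: "e * \<tau> b = e * \<phi> b * e" if b: "corner f f b" for b
    using \<tau>1_0[of b] \<tau>2(2)[of b] b by (simp_all add: \<tau>_def corner_simps)
  have h_ef: "h m = \<phi> m" if "corner e f m" for m
    using that by (simp add: h_def \<tau>_def \<tau>1_0 \<tau>2_0 corner_simps)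
  have h_fe: "h t = \<phi> t" if "corner f e t" for t
    using that by (simp add: h_def \<tau>_def \<tau>1_0 \<tau>2_0 corner_simps)
  have \<tau>_comm: "x * \<tau> y = \<tau> y * x" for x y using \<tau>_central[of y] by (simp add: centre_UNIV_iff)
  have split_\<tau>: "\<tau> x = e * \<tau> x + f * \<tau> x" for x
    using unit by (simp flip: distrib_right)
  have h_ee: "h a = e * \<phi> a * e - e * \<tau> a" if a: "corner e e a" for a
    unfolding h_def by (subst \<phi>_ee_split[OF a], subst split_\<tau>) (simp add: \<tau>_ee[OF a])
  have h_ff: "h b = f * \<phi> b * f - f * \<tau> b" if b: "corner f f b" for b
    unfolding h_def by (subst \<phi>_ff_split[OF b], subst split_\<tau>) (simp add: \<tau>_ff[OF b])
  have \<tau>_corner: "corner e e (e * \<tau> x)" "corner f f (f * \<tau> x)" for x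
    by (simp_all add: corner_def mult.assoc flip: \<tau>_comm)
  have \<tau>_slide: "m * (f * \<tau> x) = e * \<tau> x * m" if m: "corner e f m" for m x
  proof -
    have "m * (f * \<tau> x) = m * \<tau> x" using corner_right(3)[OF m] by (simp flip: mult.assoc)
    also have "\<dots> = e * (m * \<tau> x)" using corner_left(1)[OF m] by (simp flip: mult.assoc)
    also have "\<dots> = e * \<tau> x * m" by (simp only: \<tau>_comm[of m] mult.assoc)
    finally show ?thesis .
  qed
  have \<tau>_slide': "t * (e * \<tau> x) = f * \<tau> x * t" if t: "corner f e t" for t x
  proof -
    have "t * (e * \<tau> x) = t * \<tau> x" using corner_right(1)[OF t] by (simp flip: mult.assoc)
    also have "\<dots> = f * (t * \<tau> x)" using corner_left(3)[OF t] by (simp flip: mult.assoc)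
    also have "\<dots> = f * \<tau> x * t" by (simp only: \<tau>_comm[of t] mult.assoc)
    finally show ?thesis .
  qed
  have h_corner: "corner e e (h a)" if "corner e e a" for a
    using \<tau>_corner corner_compress by (simp add: h_ee[OF that] corner_diff)
  have h_corner': "corner f f (h b)" if "corner f f b" for b
    using \<tau>_corner corner_compress by (simp add: h_ff[OF that] corner_diff)
  have ee_ef: "h (a * m) = h a * m + a * h m" if a: "corner e e a" and m: "corner e f m" for a m
    using \<phi>_ee_ef[OF a m] \<tau>_slide[OF m, of a] \<tau>_ee[OF a]
    by (simp add: h_ef h_fe m corner_mult(1)[OF a m] h_ee[OF a] left_diff_distrib)
  have ef_ff: "h (m * b) = h m * b + m * h b" if m: "corner e f m" and b: "corner f f b" for m b
    using \<phi>_ef_ff[OF m b] \<tau>_slide[OF m, of b] \<tau>_ff[OF b]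
    by (simp add: h_ef h_fe m corner_mult(2)[OF m b] h_ff[OF b] right_diff_distrib)
  have fe_ee: "h (t * a) = h t * a + t * h a" if t: "corner f e t" and a: "corner e e a" for t a
    using \<phi>_fe_ee[OF t a] \<tau>_slide'[OF t, of a] \<tau>_ee[OF a]
    by (simp add: h_ef h_fe t corner_mult(1)[OF t a] h_ee[OF a] right_diff_distrib)
  have ff_fe: "h (b * t) = h b * t + b * h t" if b: "corner f f b" and t: "corner f e t" for b t
    using \<phi>_ff_fe[OF b t] \<tau>_slide'[OF t, of b] \<tau>_ff[OF b]
    by (simp add: h_ef h_fe t corner_mult(2)[OF b t] h_ff[OF b] left_diff_distrib)
  have diag_comm: "commutator (p - q) y = p * y + y * q"
    if "corner e e p" "corner f f q" "corner e f y" for p q y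
    using corner_orth(2)[OF that(2,3)] corner_orth(2)[OF that(3,1)]
    by (simp add: commutator_def left_diff_distrib right_diff_distrib)
  have ef_fe: "h (commutator m t) - commutator (h m) t - commutator m (h t) \<in> centre UNIV"
    if m: "corner e f m" and t: "corner f e t" for m t
  proof (cases "n = 2")
    case True
    then have "\<phi> (commutator m t) = commutator (\<phi> m) t + commutator m (\<phi> t)"
      using \<phi>_commutator[of m t] by simp
    then have "h (commutator m t) - commutator (h m) t - commutator m (h t) = 0 - \<tau> (commutator m t)"
      by (simp add: h_def[of "commutator m t"] h_ef h_fe m t)
    then show ?thesis using centre_diff[OF centre_0 \<tau>_central] by simp
  next
    case False
    then have n3: "3 \<le> n" using n_ge_2 by simp
    note \<phi>m = \<phi>_corner_ef[OF m] and \<phi>t = \<phi>_corner_fe[OF t]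
    define p q where "p = \<phi> m * t + m * \<phi> t" and "q = t * \<phi> m + \<phi> t * m"
    have mt: "corner e e (m * t)" "corner f f (t * m)" and p: "corner e e p" and q: "corner f f q"
      using m t \<phi>m \<phi>t by (auto simp: p_def q_def intro!: corner_add intro: corner_mult)
    \<comment> \<open>\<open>p\<close> and \<open>q\<close> are the values that the Leibniz rule predicts for \<open>h (m t)\<close> and \<open>h (t m)\<close>;
      they are compared through the two expansions of \<open>\<phi> [[m, t], m'] = \<phi> (m t m' + m' t m)\<close>.\<close>
    have "(h (m * t) - p) + (- (h (t * m) - q)) \<in> centre UNIV"
    proof (rule centre_criterion)
      show "corner e e (h (m * t) - p)" "corner f f (- (h (t * m) - q))"
        using h_corner[OF mt(1)] h_corner'[OF mt(2)] p q by (auto intro!: corner_diff corner_uminus)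
      fix m' assume m': "corner e f m'"
      have c1: "commutator (commutator m t) m' = m * t * m' + m' * (t * m)"
        unfolding commutator_def[of m t] by (rule diag_comm[OF mt m'])
      have c2: "commutator (commutator m t) (\<phi> m') = m * t * \<phi> m' + \<phi> m' * (t * m)"
        unfolding commutator_def[of m t] by (rule diag_comm[OF mt \<phi>_corner_ef[OF m']])
      have c3: "commutator (commutator (\<phi> m) t + commutator m (\<phi> t)) m' = p * m' + m' * q"
      proof -
        have "commutator (\<phi> m) t + commutator m (\<phi> t) = p - q"
          by (simp add: commutator_def p_def q_def)
        then show ?thesis using diag_comm[OF p q m'] by simp
      qed
      define u v where "u = m * t * m' + m' * (t * m)"
        and "v = p * m' + m' * q + (m * t * \<phi> m' + \<phi> m' * (t * m))"
      have u: "corner e f u" and v: "corner e f v"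
        using mt p q m' \<phi>_corner_ef[OF m']
        by (auto simp: u_def v_def intro!: corner_add intro: corner_mult)
      have "\<phi> (iter_ad (n - 3) e u) = iter_ad (n - 3) e v"
        using \<phi>_double_commutator[OF n3, of m t m'] by (simp only: c1 c2 c3 u_def v_def)
      then have "\<phi> u = v"
        using iter_ad_ef[OF u, of "n - 3"] iter_ad_ef[OF v, of "n - 3"] \<phi>_sign sign_cancel by metis
      moreover have "\<phi> u = h (m * t) * m' + m * t * \<phi> m' + (\<phi> m' * (t * m) + m' * h (t * m))"
        using ee_ef[OF mt(1) m'] ef_ff[OF m' mt(2)] corner_mult(1)[OF mt(1) m']
          corner_mult(2)[OF m' mt(2)] m'
        by (simp add: u_def \<phi>_hom h_ef h_fe)
      ultimately have "h (m * t) * m' + m' * h (t * m) = p * m' + m' * q"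
        by (simp add: v_def algebra_simps)
      then show "(h (m * t) - p) * m' = m' * - (h (t * m) - q)"
        by (simp add: algebra_simps)
    qed
    also have "(h (m * t) - p) + (- (h (t * m) - q))
        = h (commutator m t) - commutator (h m) t - commutator m (h t)"
      using h_hom by (simp add: commutator_def module_hom.diff h_ef[OF m] h_fe[OF t] p_def q_def)
    finally show ?thesis .
  qed
  interpret h: corner_derivation scale e f h
    by unfold_locales
      (use h_hom \<phi>_corner_ef \<phi>_corner_fe h_ef h_fe h_corner h_corner' ee_ef ef_ff fe_ee ff_fe ef_fe
        in \<open>simp_all add: module_hom.add\<close>)
  have "derivation scale h" unfolding derivation_def using h_hom h.leibniz by blast
  moreover have "\<phi> a = h a + \<tau> a" for a by (simp add: h_def)
  ultimately show ?thesis using \<tau>_hom \<tau>_central by blast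
qed

end

text \<open>Subtracting the inner derivation \<open>[\<cdot>, y]\<close> with \<open>y = e \<phi>(e) f - f \<phi>(e) e\<close> removes the
  off-diagonal part of \<open>\<phi> e\<close>.\<close>

lemma (in peirce_prime) normalise_by_inner_derivation:
  assumes lie: "lie_n_derivation scale n \<phi>" and n: "2 \<le> n"
    and torsion: "\<And>x::'a. of_nat (n - 1) * x = 0 \<Longrightarrow> x = 0"
  obtains d where "derivation scale d" "normalised_lie_derivation scale e f n (\<lambda>x. \<phi> x - d x)"
proof -
  define y where "y = e * \<phi> e * f - f * \<phi> e * e"
  define d where "d x = commutator x y" for x
  have d: "derivation scale d"
    unfolding derivation_def
  proof (intro conjI allI module_hom.intro module_axioms module_hom_axioms.intro)
    show "d (x * z) = d x * z + x * d z" "d (x + z) = d x + d z" for x z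
      by (simp_all add: d_def commutator_def algebra_simps)
    show "d (scale r x) = scale r (d x)" for r x
      by (simp add: d_def commutator_def scale_mult_left scale_mult_right scale_right_diff_distrib)
  qed
  define \<psi> where "\<psi> x = \<phi> x - d x" for x
  have lie': "lie_n_derivation scale n \<psi>"
    unfolding \<psi>_def by (rule lie_n_derivation_diff[OF lie derivation_is_lie_n_derivation[OF d]])
  have "d e = e * \<phi> e * f + f * \<phi> e * e"
    by (simp add: d_def commutator_def y_def left_diff_distrib right_diff_distrib mult.assoc)
  then have diag: "e * \<psi> e * f = 0" "f * \<psi> e * e = 0"
    by (simp_all add: \<psi>_def left_diff_distrib right_diff_distrib distrib_left distrib_right mult.assoc)
  have e_central: "\<psi> e \<in> centre UNIV"
    by (rule idempotent_image_central[OF lie' n torsion diag])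
  interpret m: module_hom scale scale \<psi> using lie' by (simp add: lie_n_derivation_def)
  have "iter_ad (n - 1) e (\<psi> f) = 0"
    using lie_n_derivation_padded[OF lie' e_central n, of 1 "\<lambda>_. f"] n iter_ad_diag[of f "n - 1"]
    by (simp add: m.zero)
  then have "(-1) ^ (n - 1) * (e * \<psi> f * f) = 0" "f * \<psi> f * e = 0"
    using iter_ad_compress[of "n - 1" "\<psi> f"] by simp_all
  then have "e * \<psi> f * f = 0" "f * \<psi> f * e = 0" by (cases "even (n - 1)"; simp)+
  then have "\<psi> f \<in> centre UNIV"
    using peirce_prime.idempotent_image_central[OF swap lie' n torsion] by blast
  then have "normalised_lie_derivation scale e f n \<psi>"
    by (intro normalised_lie_derivation.intro normalised_lie_derivation_axioms.intro
        peirce_prime_axioms lie' n e_central)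
  then show ?thesis using that[OF d] by (simp add: \<psi>_def[abs_def])
qed

theorem corollary3p11:
  fixes scale :: "'r::comm_ring_1 \<Rightarrow> 'a::ring_1 \<Rightarrow> 'a"
    and n :: nat and e f :: 'a
  assumes "n \<ge> 2"
    and "assoc_algebra scale"
    and "torsion_free 2 TYPE('a)"
    and "torsion_free (n - 1) TYPE('a)"
    and "prime_algebra TYPE('a)"
    and "nontrivial_idempotent e"
    and "f = 1 - e"
    and
     "(sandwich e UNIV e = idem_comm_subalgebra scale (sandwich e UNIV e) \<and>
       sandwich f UNIV f = idem_comm_subalgebra scale (sandwich f UNIV f)) \<or>
      (sandwich e UNIV e = idem_comm_subalgebra scale (sandwich e UNIV e) \<and>
       centre (sandwich e UNIV e) = sandwich e (centre UNIV) e) \<or>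
      (sandwich f UNIV f = idem_comm_subalgebra scale (sandwich f UNIV f) \<and>
       centre (sandwich f UNIV f) = sandwich f (centre UNIV) f) \<or>
      (centre (sandwich e UNIV e) = sandwich e (centre UNIV) e \<and>
       centre (sandwich f UNIV f) = sandwich f (centre UNIV) f)"
    and
     "(noncommutative (sandwich e UNIV e) \<or> noncommutative (sandwich f UNIV f)) \<or>
      (no_nonzero_central_ideal scale (sandwich e UNIV e) \<or>
       no_nonzero_central_ideal scale (sandwich f UNIV f)) \<or>
      (\<exists>m0 \<in> sandwich e UNIV f.
        centre UNIV = {a + b | a b. a \<in> sandwich e (centre UNIV) e \<and>
                                    b \<in> sandwich f (centre UNIV) f \<and> a * m0 = m0 * b}) \<or>
      (\<exists>t0 \<in> sandwich f UNIV e.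
        centre UNIV = {a + b | a b. a \<in> sandwich e (centre UNIV) e \<and>
                                    b \<in> sandwich f (centre UNIV) f \<and> t0 * a = b * t0}) \<or>
      ({x * y | x y. x \<in> sandwich e UNIV f \<and> y \<in> sandwich f UNIV e} = {0} \<and>
       {y * x | x y. x \<in> sandwich e UNIV f \<and> y \<in> sandwich f UNIV e} = {0})"
  shows "\<forall>\<phi>. lie_n_derivation scale n \<phi> \<longrightarrow> standard_lie_n_derivation scale n \<phi>"
proof (intro allI impI)
  fix \<phi> :: "'a \<Rightarrow> 'a"
  assume lie: "lie_n_derivation scale n \<phi>"
  interpret assoc_algebra scale by (rule assms(2))
  have prime: "a = 0 \<or> b = 0" if "\<And>x. a * x * b = 0" for a b :: 'a
  proof -
    have "{a * x * b |x. x \<in> UNIV} = {0}" using that by auto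
    then show ?thesis using assms(5) unfolding prime_algebra_def by blast
  qed
  have two: "x = 0" if "x + x = 0" for x :: 'a
  proof -
    have "of_nat 2 * x = 0" using that by (simp add: mult_2)
    then show ?thesis using assms(3) unfolding torsion_free_def by blast
  qed
  have e: "e * e = e" "e \<noteq> 0" "e \<noteq> 1" using assms(6) by (auto simp: nontrivial_idempotent_def)
  interpret peirce_prime scale e f
  proof unfold_locales
    show "a = 0 \<or> b = 0" if "\<And>x. a * x * b = 0" for a b :: 'a by (rule prime[OF that])
    show "x = 0" if "x + x = 0" for x :: 'a by (rule two[OF that])
  qed (use e in \<open>simp_all add: assms(7) algebra_simps\<close>)
  have torsion: "x = 0" if "of_nat (n - 1) * x = 0" for x :: 'a
    using assms(4) that unfolding torsion_free_def by blast
  obtain d where d: "derivation scale d"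
    and norm: "normalised_lie_derivation scale e f n (\<lambda>x. \<phi> x - d x)"
    using normalise_by_inner_derivation[OF lie assms(1) torsion] by blast
  interpret N: normalised_lie_derivation scale e f n "\<lambda>x. \<phi> x - d x" by (rule norm)
  interpret N': normalised_lie_derivation scale f e n "\<lambda>x. \<phi> x - d x" by (rule N.swap_normalised)
  obtain h \<tau> where h: "derivation scale h" and \<tau>: "module_hom scale scale \<tau>" "range \<tau> \<subseteq> centre UNIV"
    and sum: "\<And>a. \<phi> a - d a = h a + \<tau> a"
  proof -
    have "N.ff_part_extends a" if "corner e e a" for a
      by (rule N.ff_part_extends) (use assms(8) that in auto)
    moreover have "N'.ff_part_extends b" if "corner f f b" for b
      by (rule N'.ff_part_extends) (use assms(8) that in auto)
    ultimately show ?thesis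
      using N.standard_if_extends that unfolding N.ff_part_extends_def N'.ff_part_extends_def
      by metis
  qed
  interpret p: module_pair scale scale by unfold_locales
  have h': "derivation scale (\<lambda>x. h x + d x)"
    using h d unfolding derivation_def
    by (auto intro!: p.module_hom_add simp: algebra_simps)
  have \<phi>: "\<phi> a = (h a + d a) + \<tau> a" for a using sum[of a] by (simp add: algebra_simps)
  \<comment> \<open>As a difference of Lie \<open>n\<close>-derivations, \<open>\<tau>\<close> is one too; having central values, it
    contributes only commutators with a central entry.\<close>
  have "\<tau> = (\<lambda>a. \<phi> a - (h a + d a))" using \<phi> by auto
  then have "lie_n_derivation scale n \<tau>"
    using lie_n_derivation_diff[OF lie derivation_is_lie_n_derivation[OF h']] by simp
  then have "\<tau> (iter_comm n x) = (\<Sum>i=1..n. iter_comm n (x(i := \<tau> (x i))))" for x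
    by (simp add: lie_n_derivation_def)
  also have "\<dots> x = 0" for x
    using \<tau>(2) assms(1) by (intro sum.neutral) (auto intro!: iter_comm_central_entry)
  finally have "\<tau> (iter_comm n x) = 0" for x .
  then show "standard_lie_n_derivation scale n \<phi>"
    unfolding standard_lie_n_derivation_def using lie h' \<tau> \<phi> by blast
qed

end
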